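(* Fix an integer $d\geq 1$ and a real $p\geq 1$. Let $\mu$ be a Borel probability measure on $\mathbb{R}^d$ with $$\int_{\mathbb{R}^d} x\,\mu(dx)=0\qquad\text{and}\qquad \int_{\mathbb{R}^d}\|x\|^{2p}\,\mu(dx)<\infty .$$ Let $\mathsf{g}=\mathcal{N}(0,I_d)$. Then $$W_p(\mu*\mathsf{g},\mathsf{g})\le \frac{K_p}{1-(1-2^{-2p})^{1/p}}\left(\int_{\mathbb{R}^d}\|x\|^{2p}\,\mu(dx)\right)^{1/p},$$ where $K_p=\max\left\{1,\frac{C_p}{2}+\frac13\right\}$ and $C_p=\left(\mathbb{E}_{\xi\sim\mathcal{N}(0,1)}|\xi|^p\right)^{1/p}$.
   Context: $\|\cdot\|$ is the Euclidean norm, $*$ denotes convolution of measures, and $W_p$ is the Wasserstein-$p$ distance $W_p(\mu,\nu)=\left(\inf_{\tau\in\Pi(\mu,\nu)}\int\|z_1-z_2\|^p\,d\tau(z_1,z_2)\right)^{1/p}$, with $\Pi(\mu,\nu)$ the set of couplings of $\mu$ and $\nu$. *)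

theory Defs
  imports "HOL-Probability.Probability"
begin

text \<open>
  The marginal conditions force a coupling of probability measures to be a probability measure.
\<close>
definition couplings :: "'a measure \<Rightarrow> 'b measure \<Rightarrow> ('a \<times> 'b) measure set" where
  "couplings \<mu> \<nu> =
     {\<tau>. sets \<tau> = sets (\<mu> \<Otimes>\<^sub>M \<nu>) \<and> distr \<tau> \<mu> fst = \<mu> \<and> distr \<tau> \<nu> snd = \<nu>}"

text \<open>Real powers with exponent \<open>a > 0\<close> on \<open>[0, \<infinity>]\<close>, with \<open>\<infinity>\<close> raised to \<open>a\<close> being \<open>\<infinity>\<close>.\<close>
definition ennreal_powr :: "ennreal \<Rightarrow> real \<Rightarrow> ennreal" where
  "ennreal_powr x a = (if x = \<infinity> then \<infinity> else ennreal (enn2real x powr a))"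

text \<open>
  The distance takes values in \<open>[0, \<infinity>]\<close>: it may be infinite for measures without finite
  \<open>p\<close>-th moments, so a finite upper bound on it contains the finiteness of the transport cost.
\<close>
definition wasserstein ::
  "real \<Rightarrow> 'a::real_normed_vector measure \<Rightarrow> 'a measure \<Rightarrow> ennreal" where
  "wasserstein p \<mu> \<nu> =
     ennreal_powr
       (INF \<tau>\<in>couplings \<mu> \<nu>. \<integral>\<^sup>+ z. ennreal (norm (fst z - snd z) powr p) \<partial>\<tau>)
       (1 / p)"

definition std_gaussian :: "(real ^ 'n) measure" where
  "std_gaussian =
     density lborel
       (\<lambda>x. ennreal ((2 * pi) powr (- real CARD('n) / 2) * exp (- (norm x)\<^sup>2 / 2)))"

definition C_const :: "real \<Rightarrow> real" where
  "C_const p = (\<integral>\<xi>. \<bar>\<xi>\<bar> powr p \<partial>(density lborel (\<lambda>x. ennreal (std_normal_density x)))) powr (1 / p)"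

definition K_const :: "real \<Rightarrow> real" where
  "K_const p = max 1 (C_const p / 2 + 1 / 3)"

end

theory Submission
  imports Defs
begin

text \<open>
  Let \<open>X\<close> and \<open>X'\<close> be independent with law \<open>\<mu>\<close> and let \<open>G\<close> be standard Gaussian. Given the unordered
  pair \<open>{X, X'}\<close>, the variable \<open>X + G\<close> is a balanced mixture of two Gaussians centred at \<open>m + d\<close> and
  \<open>m - d\<close>, where \<open>m = (X + X') / 2\<close> and \<open>d = (X - X') / 2\<close>. The monotone map in the direction of \<open>d\<close>
  takes this mixture to a single Gaussian centred at \<open>m\<close>, at an \<open>L\<^sup>p\<close>-cost of at most \<open>K\<^sub>p |d|\<^sup>2\<close>. So \<open>\<mu>\<close>
  may be replaced by the law of \<open>m\<close> at cost \<open>K\<^sub>p M\<close>, where \<open>M\<close> is the \<open>L\<^sup>p\<close>-norm of \<open>|X|\<^sup>2\<close>. By the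
  inequalities of Clarkson and Jensen this multiplies the \<open>2p\<close>-th moment by at most \<open>1 - 2 powr (- 2 p)\<close>,
  so that iterating yields a geometric series. Since the transport maps are explicit, the couplings of
  consecutive steps compose without a gluing lemma.
\<close>

subsection \<open>One-dimensional monotone transport\<close>

text \<open>The cost is quadratic because, seen from m, the mixture is even in d: first-order
  effects of the two shifts cancel, and for small d the map is within O(|d|^2) of the identity. For
  |d| \<ge> 1 the trivial displacement bound |d| suffices; the maximum in \<open>K_const\<close>
  joins the two regimes. \<open>C_const\<close> enters because the leading term of the displacement
  bound is |d|^2 / 2 times the component along d of the transported point, which has law N(0, 1). A
  quadratic cost measured in L^p is what calls for moments of order 2p. The contraction factor comes
  from E|X + X'|^(2p) + E|X - X'|^(2p) \<le> 2^(2p) E|X|^(2p): since X' has mean 0, the second term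
  is at least E|X|^(2p), and dividing by 2^(2p) leaves 1 - 2^(-2p). Step costs are p-th roots of
  these moments, hence the exponent 1/p in the ratio of the series. No limiting coupling is built.
  For each e > 0, finitely many steps leave a centre of L^p-norm at most e, and e tends to 0 only in
  the final numerical bound.\<close>

definition gauss1 :: "real measure" where
  "gauss1 = density lborel (\<lambda>x. ennreal (std_normal_density x))"

section \<open>The standard normal distribution function\<close>

definition Phi :: "real \<Rightarrow> real" where "Phi = cdf gauss1"

interpretation gauss1: real_distribution gauss1
  unfolding gauss1_def by (rule real_dist_normal_dist)

lemma sets_gauss1 [measurable_cong]: "sets gauss1 = sets borel"
  by (simp add: gauss1_def)

lemma continuous_on_std_normal_density: "continuous_on S std_normal_density"
  unfolding normal_density_def by (intro continuous_intros) auto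

lemma Phi_nonneg: "0 \<le> Phi x"
  unfolding Phi_def by (rule gauss1.cdf_nonneg)

lemma measure_gauss1_Ioc:
  assumes "a \<le> b"
  shows "measure gauss1 {a<..b} = integral {a..b} std_normal_density"
proof -
  have int: "set_integrable lborel {a..b} std_normal_density"
    unfolding set_integrable_def
    by (rule integrable_mult_indicator) auto
  have "measure gauss1 {a<..b} = (LINT x|gauss1. indicator {a<..b} x)"
    by simp
  also have "\<dots> = (LINT x|lborel. indicator {a<..b} x * std_normal_density x)"
    unfolding gauss1_def by (subst integral_real_density) (auto simp: mult.commute)
  also have "\<dots> = (LINT x:{a..b}|lborel. std_normal_density x)"
    unfolding set_lebesgue_integral_def real_scaleR_def
    by (rule integral_cong_AE) (auto intro!: AE_I[where N="{a}"] simp: indicator_def)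
  also have "\<dots> = integral {a..b} std_normal_density"
    by (rule set_borel_integral_eq_integral(2)[OF int])
  finally show ?thesis .
qed

lemma DERIV_Phi: "(Phi has_real_derivative std_normal_density x) (at x)"
proof -
  have eq: "Phi u = Phi (x - 1) + integral {x - 1..u} std_normal_density" if "u \<in> {x - 1..x + 1}" for u
  proof (cases "u = x - 1")
    case False
    then have "x - 1 < u" using that by auto
    then show ?thesis
      unfolding Phi_def using gauss1.cdf_diff_eq[of "x - 1" u] measure_gauss1_Ioc[of "x - 1" u] by simp
  qed simp
  have "((\<lambda>u. integral {x - 1..u} std_normal_density) has_real_derivative std_normal_density x)
      (at x within {x - 1..x + 1})"
    by (rule integral_has_real_derivative) (auto intro: continuous_on_std_normal_density)
  then have "((\<lambda>u. Phi (x - 1) + integral {x - 1..u} std_normal_density)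
      has_real_derivative std_normal_density x) (at x within {x - 1..x + 1})"
    by (auto intro!: derivative_eq_intros)
  then have "(Phi has_real_derivative std_normal_density x) (at x within {x - 1..x + 1})"
    by (rule has_field_derivative_transform_within[where d = 1]) (auto intro!: eq[symmetric])
  moreover have "at x within {x - 1..x + 1} = at x"
    by (rule at_within_interior) auto
  ultimately show ?thesis by simp
qed

lemmas DERIV_Phi_chain [derivative_intros] = DERIV_chain2[OF DERIV_Phi]

lemma strict_mono_Phi: "strict_mono Phi"
proof (rule strict_monoI)
  fix x y :: real assume "x < y"
  then show "Phi x < Phi y"
    by (rule DERIV_pos_imp_increasing) (auto intro!: exI DERIV_Phi normal_density_pos)
qed

lemma Phi_less_iff [simp]: "Phi x < Phi y \<longleftrightarrow> x < y"
  and Phi_le_iff [simp]: "Phi x \<le> Phi y \<longleftrightarrow> x \<le> y"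
  and Phi_eq_iff [simp]: "Phi x = Phi y \<longleftrightarrow> x = y"
  by (rule strict_mono_less[OF strict_mono_Phi] strict_mono_less_eq[OF strict_mono_Phi]
      strict_mono_eq[OF strict_mono_Phi])+

lemma isCont_Phi: "isCont Phi x"
  by (rule DERIV_isCont[OF DERIV_Phi])

text \<open>The density is even, so Phi x + Phi (- x) has derivative 0; the constant is its limit at
  infinity.\<close>

lemma Phi_minus: "Phi (- x) = 1 - Phi x"
proof -
  have "((\<lambda>x. Phi x + Phi (- x)) has_real_derivative 0) (at y)" for y
    by (auto intro!: derivative_eq_intros simp: normal_density_def)
  then have const: "(\<lambda>x. Phi x + Phi (- x)) = (\<lambda>_. Phi x + Phi (- x))"
    by (intro ext DERIV_isconst_all[of "\<lambda>x. Phi x + Phi (- x)"]) auto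
  have "filterlim uminus at_bot (at_top :: real filter)"
    by (rule filterlim_uminus_at_bot_at_top)
  then have "((\<lambda>y. Phi y + Phi (- y)) \<longlongrightarrow> 1 + 0) at_top"
    using gauss1.cdf_lim_at_top_prob gauss1.cdf_lim_at_bot
    unfolding Phi_def by (intro tendsto_add) (auto intro: filterlim_compose)
  then have "((\<lambda>y::real. Phi x + Phi (- x)) \<longlongrightarrow> 1) at_top"
    by (subst (asm) const) simp
  then have "Phi x + Phi (- x) = 1"
    by (subst (asm) tendsto_const_iff) auto
  then show ?thesis by simp
qed

section \<open>The balanced mixture of N(a, 1) and N(-a, 1), with distribution function
  \<open>mixF a\<close>, and its monotone map\<close>

definition mixF :: "real \<Rightarrow> real \<Rightarrow> real" where
  "mixF a x = (Phi (x + a) + Phi (x - a)) / 2"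

lemma isCont_mixF: "isCont (mixF a) x"
  unfolding mixF_def[abs_def]
  by (rule DERIV_isCont) (auto intro!: derivative_eq_intros)

lemma strict_mono_mixF: "strict_mono (mixF a)"
proof (rule strict_monoI)
  fix x y :: real assume "x < y"
  then show "mixF a x < mixF a y"
    unfolding mixF_def by (simp add: add_strict_mono divide_strict_right_mono)
qed

lemma mixF_le_iff [simp]: "mixF a x \<le> mixF a y \<longleftrightarrow> x \<le> y"
  by (rule strict_mono_less_eq[OF strict_mono_mixF])

lemma mixF_minus: "mixF a (- x) = 1 - mixF a x"
proof -
  have "Phi (- x + a) = 1 - Phi (x - a)" "Phi (- x - a) = 1 - Phi (x + a)"
    using Phi_minus[of "x - a"] Phi_minus[of "x + a"] by simp_all
  then show ?thesis unfolding mixF_def by (simp add: field_simps)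
qed

lemma mixF_bounds:
  assumes "0 \<le> a"
  shows "Phi (x - a) \<le> mixF a x" "mixF a x \<le> Phi (x + a)"
proof -
  have "Phi (x - a) \<le> Phi (x + a)" using assms by simp
  then show "Phi (x - a) \<le> mixF a x" "mixF a x \<le> Phi (x + a)"
    unfolding mixF_def by (auto simp: field_simps)
qed

text \<open>For \<open>a \<ge> 0\<close> the description is satisfied by exactly one \<open>y\<close>, and \<open>mixT a\<close> is the monotone
  transport of the balanced mixture of \<open>N(a, 1)\<close> and \<open>N(-a, 1)\<close> to \<open>N(0, 1)\<close>. It is unspecified for \<open>a < 0\<close>.\<close>

definition mixT :: "real \<Rightarrow> real \<Rightarrow> real" where
  "mixT a x = (THE y. Phi y = mixF a x)"

text \<open>The location of y matters as much as its existence: it is the displacement bound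
  \<open>mixT_dist\<close>.\<close>

lemma Phi_eq_mixF_ex:
  assumes "0 \<le> a"
  shows "\<exists>y. x - a \<le> y \<and> y \<le> x + a \<and> Phi y = mixF a x"
proof (rule IVT)
  show "\<forall>y. x - a \<le> y \<and> y \<le> x + a \<longrightarrow> isCont Phi y" by (simp add: isCont_Phi)
qed (use assms mixF_bounds[OF assms] in auto)

lemma Phi_mixT:
  assumes "0 \<le> a"
  shows "Phi (mixT a x) = mixF a x"
proof -
  obtain y where "Phi y = mixF a x" using Phi_eq_mixF_ex[OF assms, of x] by blast
  then have "\<exists>!y. Phi y = mixF a x" by (intro ex1I[of _ y]) (auto dest: sym)
  then show ?thesis unfolding mixT_def by (rule theI')
qed

lemma mixT_eqI: "0 \<le> a \<Longrightarrow> Phi y = mixF a x \<Longrightarrow> mixT a x = y"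
  using Phi_mixT[of a x] by (metis Phi_eq_iff)

lemma mixT_dist:
  assumes "0 \<le> a"
  shows "\<bar>mixT a x - x\<bar> \<le> a"
proof -
  obtain y where "x - a \<le> y" "y \<le> x + a" "Phi y = mixF a x"
    using Phi_eq_mixF_ex[OF assms, of x] by blast
  then show ?thesis using mixT_eqI[OF assms, of y x] by simp
qed

lemma mixT_minus:
  assumes "0 \<le> a"
  shows "mixT a (- x) = - mixT a x"
proof (rule mixT_eqI[OF assms])
  show "Phi (- mixT a x) = mixF a (- x)"
    by (simp add: Phi_minus mixF_minus Phi_mixT[OF assms])
qed

text \<open>Replaces the definite description by an inequality between distribution functions; both
  measurability and the law of the image are read off from it.\<close>

lemma mixT_le_iff:
  assumes "0 \<le> a"
  shows "mixT a x \<le> c \<longleftrightarrow> mixF a x \<le> Phi c"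
  using Phi_le_iff[of "mixT a x" c] Phi_mixT[OF assms, of x] by simp

text \<open>This is tanh u \<le> u \<le> s with the denominator of tanh cleared.\<close>

lemma exp_tanh_ineq:
  fixes u s :: real
  assumes "0 \<le> u" "u \<le> s"
  shows "0 \<le> exp (- (2 * u)) * (s + 1) + (s - 1)"
proof -
  define f where "f = (\<lambda>u::real. exp (- (2 * u)) * (u + 1) + (u - 1))"
  have "f 0 \<le> f u"
  proof (rule DERIV_nonneg_imp_nondecreasing[OF assms(1)])
    fix x :: real assume "0 \<le> x"
    have *: "(1 + 2 * x) * exp (- (2 * x)) \<le> exp (2 * x) * exp (- (2 * x))"
      using exp_ge_add_one_self[of "2 * x"] by (intro mult_right_mono) auto
    have "(f has_real_derivative (1 - (1 + 2 * x) * exp (- (2 * x)))) (at x)"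
      unfolding f_def by (auto intro!: derivative_eq_intros simp: algebra_simps)
    moreover have "1 - (1 + 2 * x) * exp (- (2 * x)) \<ge> 0"
      using * by (simp flip: exp_add)
    ultimately show "\<exists>y. (f has_real_derivative y) (at x) \<and> 0 \<le> y" by blast
  qed
  also have "f u \<le> exp (- (2 * u)) * (s + 1) + (s - 1)"
    unfolding f_def using assms by (intro add_mono mult_left_mono) auto
  finally show ?thesis by (simp add: f_def)
qed

text \<open>Separating the two centres lowers the distribution function at y \<ge> 0: its derivative
  in t is (phi (y + t) - phi (y - t)) / 2 with phi the normal density, and |y - t| \<le> y + t.
  Consequently \<open>mixT\<close> moves points towards 0.\<close>

lemma mixF_le_Phi:
  assumes "0 \<le> a" "0 \<le> y"
  shows "mixF a y \<le> Phi y"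
proof -
  have "mixF a y \<le> mixF 0 y"
  proof (rule DERIV_nonpos_imp_nonincreasing[OF assms(1), of "\<lambda>t. mixF t y"])
    fix t :: real assume t: "0 \<le> t"
    have "((\<lambda>t. mixF t y) has_real_derivative
        (std_normal_density (y + t) - std_normal_density (y - t)) / 2) (at t)"
      unfolding mixF_def by (auto intro!: derivative_eq_intros simp: field_simps)
    moreover have "std_normal_density (y + t) \<le> std_normal_density (y - t)"
      using t assms(2) mult_nonneg_nonneg[of t y]
      by (auto simp: normal_density_def power2_eq_square algebra_simps intro!: divide_right_mono)
    ultimately show "\<exists>d. ((\<lambda>t. mixF t y) has_real_derivative d) (at t) \<and> d \<le> 0"
      by (intro exI conjI) auto
  qed
  then show ?thesis by (simp add: mixF_def)
qed

text \<open>The quantile \<open>q\<^sub>t\<close> of the mixture with parameter \<open>t\<close> at level \<open>Phi y\<close> solves \<open>q' = tanh (t q)\<close> with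
  \<open>q\<^sub>0 = y\<close>. Hence \<open>q\<^sub>t \<le> y + t\<close>, so \<open>q' \<le> t (y + t)\<close>, which integrates to the bound below.\<close>

lemma Phi_le_mixF_shift:
  assumes "0 \<le> a" "0 \<le> y"
  shows "Phi y \<le> mixF a (y + a\<^sup>2 * y / 2 + a ^ 3 / 3)"
proof -
  define r where "r t = y + t\<^sup>2 * y / 2 + t ^ 3 / 3" for t
  \<comment> \<open>If the claimed shift exceeds a, the shift by a alone is already enough.\<close>
  have triv: "Phi y \<le> mixF a (r a)" if "y + a \<le> r a"
  proof -
    have "Phi y \<le> mixF a (y + a)" using mixF_bounds(1)[OF assms(1), of "y + a"] by simp
    also have "\<dots> \<le> mixF a (r a)" using that by simp
    finally show ?thesis .
  qed
  have "Phi y \<le> mixF a (r a)"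
  proof (cases "r a \<le> y + a")
    case True
    \<comment> \<open>(r t - y) / t = t y / 2 + t^2 / 3 increases with t, so the inequality at t = a
      passes to all smaller t.\<close>
    have *: "r t \<le> y + t" if "0 \<le> t" "t \<le> a" for t
    proof (cases "a = 0")
      case False
      with assms have a: "0 < a" by simp
      have "a * (a * y / 2 + a\<^sup>2 / 3) \<le> a * 1"
        using True by (simp add: r_def power2_eq_square power3_eq_cube algebra_simps)
      then have "a * y / 2 + a\<^sup>2 / 3 \<le> 1" using a by simp
      moreover have "t * y / 2 + t\<^sup>2 / 3 \<le> a * y / 2 + a\<^sup>2 / 3"
        using that assms by (intro add_mono divide_right_mono mult_right_mono power_mono) auto
      ultimately have "t * (t * y / 2 + t\<^sup>2 / 3) \<le> t * 1"
        using that by (intro mult_left_mono) auto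
      then show ?thesis by (simp add: r_def power2_eq_square power3_eq_cube algebra_simps)
    qed (use that in \<open>auto simp: r_def\<close>)
    have "mixF 0 (r 0) \<le> mixF a (r a)"
    proof (rule DERIV_nonneg_imp_nondecreasing[OF assms(1), of "\<lambda>t. mixF t (r t)"])
      fix t assume t: "0 \<le> t" "t \<le> a"
      \<comment> \<open>s is r' (t). The derivative of \<open>mixF t (r t)\<close> in t is
        nonnegative exactly when tanh (t * r t) \<le> s.\<close>
      define s where "s = t * (y + t)"
      have dr: "(r has_real_derivative s) (at t)"
        unfolding r_def[abs_def] s_def
        by (auto intro!: derivative_eq_intros simp: power2_eq_square algebra_simps)
      have d: "((\<lambda>t. mixF t (r t)) has_real_derivative
        (std_normal_density (r t + t) * (s + 1) + std_normal_density (r t - t) * (s - 1)) / 2) (at t)"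
        unfolding mixF_def by (auto intro!: derivative_eq_intros dr simp: field_simps)
      have r0: "0 \<le> r t" unfolding r_def using assms t by auto
      \<comment> \<open>Here r t \<le> y + t is used: it gives t * r t \<le> t * (y + t) =
        s.\<close>
      have "0 \<le> exp (- (2 * (t * r t))) * (s + 1) + (s - 1)"
        using t r0 * by (intro exp_tanh_ineq) (auto simp: s_def intro: mult_left_mono)
      moreover have "std_normal_density (r t + t) = std_normal_density (r t - t) * exp (- (2 * (t * r t)))"
        by (simp add: normal_density_def power2_eq_square algebra_simps add_divide_distrib diff_divide_distrib flip: exp_add)
      ultimately have "0 \<le> std_normal_density (r t - t) * (exp (- (2 * (t * r t))) * (s + 1) + (s - 1))"
        by (intro mult_nonneg_nonneg) auto
      also have "\<dots> = std_normal_density (r t + t) * (s + 1) + std_normal_density (r t - t) * (s - 1)"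
        using \<open>std_normal_density (r t + t) = _\<close> by (simp add: algebra_simps)
      finally show "\<exists>d. ((\<lambda>t. mixF t (r t)) has_real_derivative d) (at t) \<and> 0 \<le> d"
        using d by (intro exI[of _ "_ / 2"] conjI) auto
    qed
    then show ?thesis by (simp add: mixF_def r_def)
  qed (use triv in auto)
  then show ?thesis by (simp add: r_def)
qed

text \<open>For y = \<open>mixT a x\<close> \<ge> 0 the two preceding lemmas enclose x between y and
  y + a^2 y / 2 + a^3 / 3; oddness handles y < 0. The bound is in terms of the image rather than x
  because it is the image that has law N(0, 1).\<close>

lemma mixT_dist_small:
  assumes "0 \<le> a"
  shows "\<bar>mixT a x - x\<bar> \<le> a\<^sup>2 / 2 * \<bar>mixT a x\<bar> + a ^ 3 / 3"
proof -
  have pos: "\<bar>mixT a x - x\<bar> \<le> a\<^sup>2 / 2 * \<bar>mixT a x\<bar> + a ^ 3 / 3" if "0 \<le> mixT a x" for x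
  proof -
    have "mixF a (mixT a x) \<le> mixF a x"
      using mixF_le_Phi[OF assms that] Phi_mixT[OF assms] by simp
    moreover have "mixF a x \<le> mixF a (mixT a x + a\<^sup>2 * mixT a x / 2 + a ^ 3 / 3)"
      using Phi_le_mixF_shift[OF assms that] Phi_mixT[OF assms] by simp
    ultimately show ?thesis using that by simp
  qed
  show ?thesis
  proof (cases "0 \<le> mixT a x")
    case False
    then show ?thesis using pos[of "- x"] by (simp add: mixT_minus[OF assms])
  qed (rule pos)
qed

lemma borel_measurable_Phi [measurable]: "Phi \<in> borel_measurable borel"
  by (rule borel_measurable_mono) (simp add: mono_def)

text \<open>The absolute value keeps the parameter where \<open>mixT\<close> is specified. Joint
  measurability is required because the parameter will be random.\<close>

lemma borel_measurable_mixT [measurable]: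
  assumes [measurable]: "f \<in> borel_measurable M" "g \<in> borel_measurable M"
  shows "(\<lambda>x. mixT \<bar>f x\<bar> (g x)) \<in> borel_measurable M"
proof (rule borel_measurableI_le)
  fix c
  have "{x \<in> space M. mixT \<bar>f x\<bar> (g x) \<le> c} = {x \<in> space M. mixF \<bar>f x\<bar> (g x) \<le> Phi c}"
    by (simp add: mixT_le_iff)
  also have "\<dots> \<in> sets M" unfolding mixF_def by measurable
  finally show "{x \<in> space M. mixT \<bar>f x\<bar> (g x) \<le> c} \<in> sets M" .
qed

text \<open>Provides the preimage of c under \<open>mixT a\<close>.\<close>

lemma mixF_surj:
  assumes "0 \<le> a"
  shows "\<exists>x. mixF a x = Phi c"
proof -
  have "\<exists>x\<ge>c - a. x \<le> c + a \<and> mixF a x = Phi c"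
    using assms mixF_bounds[OF assms, of "c - a"] mixF_bounds[OF assms, of "c + a"]
    by (intro IVT) (auto intro: isCont_mixF)
  then show ?thesis by blast
qed

text \<open>Says that \<open>mixT a\<close> carries the mixture to N(0, 1), with the weights 1/2
  multiplied out. A fair coin choosing the sign of the shift realises the mixture as a law on a
  product space, and the image is identified by its distribution function.\<close>

lemma nn_integral_mixT:
  assumes "0 \<le> a" and f [measurable]: "f \<in> borel_measurable borel"
  shows "(\<integral>\<^sup>+\<xi>. f (mixT a (\<xi> + a)) + f (mixT a (\<xi> - a)) \<partial>gauss1) = 2 * (\<integral>\<^sup>+\<xi>. f \<xi> \<partial>gauss1)"
proof -
  have "(\<lambda>x. mixT \<bar>a\<bar> x) \<in> borel_measurable borel"
    by (rule borel_measurable_mixT) simp_all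
  then have [measurable]: "mixT a \<in> borel_measurable borel"
    unfolding abs_of_nonneg[OF assms(1)] .
  let ?P = "distr gauss1 borel (\<lambda>\<xi>. mixT a (\<xi> + a))"
  let ?Q = "distr gauss1 borel (\<lambda>\<xi>. mixT a (\<xi> - a))"
  let ?B = "measure_pmf (bernoulli_pmf (1/2))"
  define h where "h = (\<lambda>(b, \<xi>). mixT a (if b then \<xi> + a else \<xi> - a))"
  have [measurable]: "h \<in> borel_measurable (?B \<Otimes>\<^sub>M gauss1)"
    unfolding h_def case_prod_beta
    by (intro measurable_compose[OF _ \<open>mixT a \<in> borel_measurable borel\<close>] measurable_If) measurable
  interpret B: prob_space ?B by (rule prob_space_measure_pmf)
  interpret pair_prob_space ?B gauss1 ..
  have int: "(\<integral>\<^sup>+\<omega>. k (h \<omega>) \<partial>(?B \<Otimes>\<^sub>M gauss1))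
      = ((\<integral>\<^sup>+\<xi>. k (mixT a (\<xi> + a)) \<partial>gauss1) + (\<integral>\<^sup>+\<xi>. k (mixT a (\<xi> - a)) \<partial>gauss1)) * ennreal (1/2)"
    if [measurable]: "k \<in> borel_measurable borel" for k
  proof -
    have "(\<integral>\<^sup>+\<omega>. k (h \<omega>) \<partial>(?B \<Otimes>\<^sub>M gauss1)) = (\<integral>\<^sup>+b. \<integral>\<^sup>+\<xi>. k (h (b, \<xi>)) \<partial>gauss1 \<partial>?B)"
      by (rule gauss1.nn_integral_fst[symmetric]) measurable
    also have "\<dots> = (\<integral>\<^sup>+\<xi>. k (mixT a (\<xi> + a)) \<partial>gauss1) * ennreal (1/2)
        + (\<integral>\<^sup>+\<xi>. k (mixT a (\<xi> - a)) \<partial>gauss1) * ennreal (1/2)"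
      by (subst nn_integral_bernoulli_pmf) (simp_all add: h_def)
    finally show ?thesis by (simp add: distrib_right)
  qed
  have "distr (?B \<Otimes>\<^sub>M gauss1) borel h = gauss1"
  proof (rule cdf_unique)
    show "real_distribution (distr (?B \<Otimes>\<^sub>M gauss1) borel h)"
      by (rule real_distribution_distr) simp
    show "real_distribution gauss1" ..
    show "cdf (distr (?B \<Otimes>\<^sub>M gauss1) borel h) = cdf gauss1"
    proof
      fix c
      obtain x where x: "mixF a x = Phi c" using mixF_surj[OF assms(1)] by blast
      \<comment> \<open>By monotonicity the event that the image is at most c is a half-line, whose
        mass under each shifted normal law is a value of \<open>Phi\<close>.\<close>
      have iff: "mixT a z \<le> c \<longleftrightarrow> z \<le> x" for z
        by (simp add: mixT_le_iff[OF assms(1)] flip: x)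
      have meas: "(\<integral>\<^sup>+\<xi>. indicator {..c} (mixT a (\<xi> + b)) \<partial>gauss1) = ennreal (Phi (x - b))" for b
      proof -
        have "(\<integral>\<^sup>+\<xi>. indicator {..c} (mixT a (\<xi> + b)) \<partial>gauss1) = (\<integral>\<^sup>+\<xi>. indicator {..x - b} \<xi> \<partial>gauss1)"
          by (rule nn_integral_cong) (auto simp: indicator_def iff)
        also have "\<dots> = ennreal (Phi (x - b))"
          by (simp add: Phi_def cdf_def gauss1.emeasure_eq_measure)
        finally show ?thesis .
      qed
      have "emeasure (distr (?B \<Otimes>\<^sub>M gauss1) borel h) {..c} = (\<integral>\<^sup>+y. indicator {..c} y \<partial>distr (?B \<Otimes>\<^sub>M gauss1) borel h)"
        by (rule nn_integral_indicator[symmetric]) simp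
      also have "\<dots> = (\<integral>\<^sup>+\<omega>. indicator {..c} (h \<omega>) \<partial>(?B \<Otimes>\<^sub>M gauss1))"
        by (rule nn_integral_distr) simp_all
      also have "\<dots> = (ennreal (Phi (x - a)) + ennreal (Phi (x - - a))) * ennreal (1/2)"
        using meas[of a] meas[of "-a"] by (subst int) auto
      also have "\<dots> = ennreal (mixF a x)"
      proof -
        have "ennreal (Phi (x - a)) + ennreal (Phi (x - - a)) = ennreal (Phi (x - a) + Phi (x + a))"
          by (simp add: Phi_nonneg flip: ennreal_plus)
        moreover have "ennreal (Phi (x - a) + Phi (x + a)) * ennreal (1/2)
          = ennreal ((Phi (x - a) + Phi (x + a)) * (1/2))"
          by (rule ennreal_mult[symmetric]) (simp_all add: Phi_nonneg)
        ultimately show ?thesis by (simp only: mixF_def) (simp add: add.commute)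
      qed
      finally show "cdf (distr (?B \<Otimes>\<^sub>M gauss1) borel h) c = cdf gauss1 c"
        by (simp add: cdf_def2 measure_def x Phi_nonneg flip: Phi_def)
    qed
  qed
  then have "(\<integral>\<^sup>+\<xi>. f \<xi> \<partial>gauss1) = (\<integral>\<^sup>+\<xi>. f \<xi> \<partial>distr (?B \<Otimes>\<^sub>M gauss1) borel h)" by simp
  also have "\<dots> = ((\<integral>\<^sup>+\<xi>. f (mixT a (\<xi> + a)) \<partial>gauss1) + (\<integral>\<^sup>+\<xi>. f (mixT a (\<xi> - a)) \<partial>gauss1)) * ennreal (1/2)"
    by (simp add: nn_integral_distr int)
  finally have "2 * (\<integral>\<^sup>+\<xi>. f \<xi> \<partial>gauss1)
    = ((\<integral>\<^sup>+\<xi>. f (mixT a (\<xi> + a)) \<partial>gauss1) + (\<integral>\<^sup>+\<xi>. f (mixT a (\<xi> - a)) \<partial>gauss1)) * (ennreal (1/2) * ennreal 2)"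
    by (simp only: mult.assoc ennreal_numeral mult.commute[of 2])
  also have "ennreal (1/2) * ennreal 2 = 1"
    by (subst ennreal_mult[symmetric]) auto
  finally show ?thesis
    by (simp add: nn_integral_add)
qed

subsection \<open>Transport along a direction in Euclidean space\<close>

definition gauss_density :: "real ^ 'n \<Rightarrow> real" where
  "gauss_density x = (2 * pi) powr (- real CARD('n) / 2) * exp (- (norm x)\<^sup>2 / 2)"

lemma gauss_density_nonneg [simp]: "0 \<le> gauss_density x"
  by (simp add: gauss_density_def)

lemma borel_measurable_gauss_density [measurable]: "gauss_density \<in> borel_measurable borel"
  unfolding gauss_density_def[abs_def] by measurable

lemma std_gaussian_eq: "std_gaussian = density lborel (\<lambda>x. ennreal (gauss_density x))"
  by (simp add: std_gaussian_def gauss_density_def)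

lemma sets_std_gaussian [simp, measurable_cong]: "sets std_gaussian = sets borel"
  and space_std_gaussian [simp]: "space std_gaussian = UNIV"
  by (simp_all add: std_gaussian_eq)

lemma gauss_density_prod:
  "gauss_density x = (\<Prod>b\<in>Basis. std_normal_density (x \<bullet> b))" for x :: "real ^ 'n"
proof -
  have "(\<Prod>b\<in>(Basis :: (real ^ 'n) set). std_normal_density (x \<bullet> b))
      = (1 / sqrt (2 * pi)) ^ CARD('n) * exp (\<Sum>b\<in>Basis. - (x \<bullet> b)\<^sup>2 / 2)"
    unfolding std_normal_density_def prod.distrib by (simp add: exp_sum)
  also have "(\<Sum>b\<in>Basis. - (x \<bullet> b)\<^sup>2 / 2) = - (norm x)\<^sup>2 / 2"
    unfolding power2_norm_eq_inner by (subst euclidean_inner)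
      (simp add: power2_eq_square sum_negf flip: sum_divide_distrib)
  also have "(1 / sqrt (2 * pi)) ^ CARD('n) = ((2 * pi) powr (- 1 / 2)) powr CARD('n)"
    by (simp add: powr_minus powr_half_sqrt powr_realpow field_simps)
  also have "\<dots> = (2 * pi) powr (- real CARD('n) / 2)"
    by (simp only: powr_powr) simp
  finally show ?thesis by (simp add: gauss_density_def)
qed

lemma prob_space_std_gaussian: "prob_space (std_gaussian :: (real ^ 'n) measure)"
proof
  have "emeasure (std_gaussian :: (real ^ 'n) measure) (space std_gaussian)
      = (\<integral>\<^sup>+x. (\<Prod>b\<in>(Basis :: (real ^ 'n) set). ennreal (std_normal_density (x \<bullet> b))) \<partial>lborel)"
    unfolding std_gaussian_eq
    by (subst emeasure_density) (auto simp: gauss_density_prod prod_ennreal prod_nonneg)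
  also have "\<dots> = (\<Prod>b\<in>(Basis :: (real ^ 'n) set). \<integral>\<^sup>+x. ennreal (std_normal_density x) \<partial>lborel)"
    by (rule nn_integral_lborel_prod) auto
  also have "\<dots> = 1"
    by (subst nn_integral_eq_integral) auto
  finally show "emeasure (std_gaussian :: (real ^ 'n) measure) (space std_gaussian) = 1" .
qed

lemma nn_integral_lborel_translation:
  fixes f :: "'a::euclidean_space \<Rightarrow> ennreal"
  assumes [measurable]: "f \<in> borel_measurable borel"
  shows "(\<integral>\<^sup>+x. f (x + c) \<partial>lborel) = (\<integral>\<^sup>+x. f x \<partial>lborel)"
proof -
  have "(\<integral>\<^sup>+x. f x \<partial>lborel) = (\<integral>\<^sup>+x. f x \<partial>distr lborel borel ((+) c))"
    by (simp add: lborel_distr_plus)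
  also have "\<dots> = (\<integral>\<^sup>+x. f (x + c) \<partial>lborel)"
    by (subst nn_integral_distr) (auto simp: add.commute)
  finally show ?thesis by simp
qed

text \<open>The quarter turn in the plane spanned by \<open>e\<close> and the auxiliary axis is a product of
  three shears, each of which preserves Lebesgue measure by Fubini and translation invariance.\<close>

lemma nn_integral_lborel_quarter_turn:
  fixes h :: "'a::euclidean_space \<times> real \<Rightarrow> ennreal"
  assumes h [measurable]: "h \<in> borel_measurable borel" and e: "norm e = 1"
  shows "(\<integral>\<^sup>+z. \<integral>\<^sup>+\<xi>. h (z + \<xi> *\<^sub>R e - (z \<bullet> e) *\<^sub>R e, - (z \<bullet> e)) \<partial>lborel \<partial>lborel)
    = (\<integral>\<^sup>+z. \<integral>\<^sup>+\<xi>. h (z, \<xi>) \<partial>lborel \<partial>lborel)"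
proof -
  have ee: "e \<bullet> e = 1" using e by (simp add: dot_square_norm)
  have shear1: "(\<integral>\<^sup>+z. \<integral>\<^sup>+\<xi>. k (z + \<xi> *\<^sub>R e, \<xi>) \<partial>lborel \<partial>lborel) = (\<integral>\<^sup>+z. \<integral>\<^sup>+\<xi>. k (z, \<xi>) \<partial>lborel \<partial>lborel)"
    if [measurable]: "k \<in> borel_measurable (borel \<Otimes>\<^sub>M borel)" for k :: "'a \<times> real \<Rightarrow> ennreal"
  proof -
    have "(\<integral>\<^sup>+z. \<integral>\<^sup>+\<xi>. k (z + \<xi> *\<^sub>R e, \<xi>) \<partial>lborel \<partial>lborel) = (\<integral>\<^sup>+\<xi>. \<integral>\<^sup>+z. k (z + \<xi> *\<^sub>R e, \<xi>) \<partial>lborel \<partial>lborel)"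
      by (rule lborel_pair.Fubini') measurable
    also have "\<dots> = (\<integral>\<^sup>+\<xi>. \<integral>\<^sup>+z. k (z, \<xi>) \<partial>lborel \<partial>lborel)"
      by (intro nn_integral_cong nn_integral_lborel_translation[where f = "\<lambda>z. k (z, _)"]) measurable
    also have "\<dots> = (\<integral>\<^sup>+z. \<integral>\<^sup>+\<xi>. k (z, \<xi>) \<partial>lborel \<partial>lborel)"
      by (rule lborel_pair.Fubini'[symmetric]) measurable
    finally show ?thesis .
  qed
  have shear2: "(\<integral>\<^sup>+z. \<integral>\<^sup>+\<xi>. k (z, \<xi> - z \<bullet> e) \<partial>lborel \<partial>lborel) = (\<integral>\<^sup>+z. \<integral>\<^sup>+\<xi>. k (z, \<xi>) \<partial>lborel \<partial>lborel)"
    if [measurable]: "k \<in> borel_measurable (borel \<Otimes>\<^sub>M borel)" for k :: "'a \<times> real \<Rightarrow> ennreal"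
  proof (rule nn_integral_cong)
    fix z
    show "(\<integral>\<^sup>+\<xi>. k (z, \<xi> - z \<bullet> e) \<partial>lborel) = (\<integral>\<^sup>+\<xi>. k (z, \<xi>) \<partial>lborel)"
      using nn_integral_lborel_translation[of "\<lambda>\<xi>. k (z, \<xi>)" "- (z \<bullet> e)"] by simp
  qed
  have [measurable]: "h \<in> borel_measurable (borel \<Otimes>\<^sub>M borel)" using h by (simp add: borel_prod)
  have "(\<integral>\<^sup>+z. \<integral>\<^sup>+\<xi>. h (z, \<xi>) \<partial>lborel \<partial>lborel) = (\<integral>\<^sup>+z. \<integral>\<^sup>+\<xi>. h (z + \<xi> *\<^sub>R e, \<xi>) \<partial>lborel \<partial>lborel)"
    by (rule shear1[symmetric]) measurable
  also have "\<dots> = (\<integral>\<^sup>+z. \<integral>\<^sup>+\<xi>. h (z + (\<xi> - z \<bullet> e) *\<^sub>R e, \<xi> - z \<bullet> e) \<partial>lborel \<partial>lborel)"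
    by (rule shear2[where k = "\<lambda>(z, \<xi>). h (z + \<xi> *\<^sub>R e, \<xi>)", unfolded prod.case, symmetric]) measurable
  also have "\<dots> = (\<integral>\<^sup>+z. \<integral>\<^sup>+\<xi>. h (z + \<xi> *\<^sub>R e + (\<xi> - (z + \<xi> *\<^sub>R e) \<bullet> e) *\<^sub>R e, \<xi> - (z + \<xi> *\<^sub>R e) \<bullet> e) \<partial>lborel \<partial>lborel)"
    by (rule shear1[where k = "\<lambda>(z, \<xi>). h (z + (\<xi> - z \<bullet> e) *\<^sub>R e, \<xi> - z \<bullet> e)", unfolded prod.case, symmetric]) measurable
  \<comment> \<open>As e is a unit vector, \<xi> cancels from the auxiliary coordinate: \<xi> - (z +
    \<xi> e) . e = - (z . e).\<close>
  also have "\<dots> = (\<integral>\<^sup>+z. \<integral>\<^sup>+\<xi>. h (z + \<xi> *\<^sub>R e - (z \<bullet> e) *\<^sub>R e, - (z \<bullet> e)) \<partial>lborel \<partial>lborel)"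
    by (simp add: inner_add_left ee)
  finally show ?thesis by simp
qed

text \<open>Rotation invariance in the form used below: the component of z along e may be replaced
  by an independent N(0, 1) variable. The quarter turn exchanges that component, up to sign, with
  the auxiliary coordinate.\<close>

lemma nn_integral_std_gaussian_split:
  fixes f :: "real ^ 'n \<Rightarrow> ennreal"
  assumes f [measurable]: "f \<in> borel_measurable borel" and e: "norm e = 1"
  shows "(\<integral>\<^sup>+z. \<integral>\<^sup>+\<xi>. f (z + \<xi> *\<^sub>R e - (z \<bullet> e) *\<^sub>R e) \<partial>gauss1 \<partial>std_gaussian) = (\<integral>\<^sup>+z. f z \<partial>std_gaussian)"
proof -
  have ee: "e \<bullet> e = 1" using e by (simp add: dot_square_norm)
  define h where "h = (\<lambda>(w :: real ^ 'n, s). f w * ennreal (gauss_density w) * ennreal (std_normal_density s))"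
  have h: "h \<in> borel_measurable borel"
    unfolding h_def borel_prod[symmetric] by measurable
  \<comment> \<open>The quarter turn preserves the sum of squared norms, hence the joint
    density.\<close>
  have dens: "gauss_density z * std_normal_density \<xi>
      = gauss_density (z + \<xi> *\<^sub>R e - (z \<bullet> e) *\<^sub>R e) * std_normal_density (- (z \<bullet> e))" for z \<xi>
  proof -
    have "(norm (z + \<xi> *\<^sub>R e - (z \<bullet> e) *\<^sub>R e))\<^sup>2 + (z \<bullet> e)\<^sup>2 = (norm z)\<^sup>2 + \<xi>\<^sup>2"
      unfolding power2_norm_eq_inner
      by (simp add: inner_simps ee inner_commute[of e z] power2_eq_square algebra_simps)
    then have "exp (- (norm z)\<^sup>2 / 2) * exp (- \<xi>\<^sup>2 / 2)
      = exp (- (norm (z + \<xi> *\<^sub>R e - (z \<bullet> e) *\<^sub>R e))\<^sup>2 / 2) * exp (- (z \<bullet> e)\<^sup>2 / 2)"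
      by (simp flip: exp_add add: field_simps)
    then show ?thesis
      by (simp add: gauss_density_def std_normal_density_def)
  qed
  have "(\<integral>\<^sup>+z. \<integral>\<^sup>+\<xi>. f (z + \<xi> *\<^sub>R e - (z \<bullet> e) *\<^sub>R e) \<partial>gauss1 \<partial>std_gaussian)
    = (\<integral>\<^sup>+z. \<integral>\<^sup>+\<xi>. ennreal (gauss_density z * std_normal_density \<xi>) * f (z + \<xi> *\<^sub>R e - (z \<bullet> e) *\<^sub>R e) \<partial>lborel \<partial>lborel)"
    unfolding std_gaussian_eq gauss1_def
    by (simp add: nn_integral_density ennreal_mult mult.assoc nn_integral_cmult)
  also have "\<dots> = (\<integral>\<^sup>+z. \<integral>\<^sup>+\<xi>. h (z + \<xi> *\<^sub>R e - (z \<bullet> e) *\<^sub>R e, - (z \<bullet> e)) \<partial>lborel \<partial>lborel)"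
    by (intro nn_integral_cong) (subst dens, simp add: h_def ennreal_mult mult_ac)
  also have "\<dots> = (\<integral>\<^sup>+z. \<integral>\<^sup>+\<xi>. h (z, \<xi>) \<partial>lborel \<partial>lborel)"
    by (rule nn_integral_lborel_quarter_turn[OF h e])
  also have "\<dots> = (\<integral>\<^sup>+z. f z * ennreal (gauss_density z) \<partial>lborel)"
    unfolding h_def by (simp add: nn_integral_cmult nn_integral_eq_integral)
  also have "\<dots> = (\<integral>\<^sup>+z. f z \<partial>std_gaussian)"
    unfolding std_gaussian_eq by (simp add: nn_integral_density mult.commute)
  finally show ?thesis .
qed

text \<open>Applies \<open>mixT\<close> to the component along d and fixes the orthogonal part.
  Since \<open>sgn 0 = 0\<close>, it is the identity for d = 0.\<close>

definition mixS :: "real ^ 'n \<Rightarrow> real ^ 'n \<Rightarrow> real ^ 'n" where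
  "mixS d z = z + (mixT (norm d) (z \<bullet> sgn d) - z \<bullet> sgn d) *\<^sub>R sgn d"

lemma borel_measurable_mixS [measurable]:
  assumes [measurable]: "f \<in> borel_measurable M" "g \<in> borel_measurable M"
  shows "(\<lambda>x. mixS (f x) (g x)) \<in> borel_measurable M"
proof -
  have "(\<lambda>x. mixT \<bar>norm (f x)\<bar> (g x \<bullet> sgn (f x))) \<in> borel_measurable M"
    unfolding sgn_div_norm by measurable
  then have [measurable]: "(\<lambda>x. mixT (norm (f x)) (g x \<bullet> (f x /\<^sub>R norm (f x)))) \<in> borel_measurable M"
    by (simp add: sgn_div_norm)
  show ?thesis unfolding mixS_def sgn_div_norm by measurable
qed

text \<open>\<open>mixT\<close> is odd, so the sign of d cancels. Hence the map depends only on the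
  unordered pair behind d.\<close>

lemma mixS_minus: "mixS (- d) z = mixS d z"
  by (simp add: mixS_def sgn_minus mixT_minus algebra_simps)

lemma mixS_dist: "norm (mixS d z - z) \<le> norm d"
  using mixT_dist[of "norm d" "z \<bullet> sgn d"] by (auto simp: mixS_def norm_sgn)

lemma mixS_dist_small:
  "norm (mixS d z - z) \<le> (norm d)\<^sup>2 / 2 * \<bar>mixS d z \<bullet> sgn d\<bar> + norm d ^ 3 / 3"
proof (cases "d = 0")
  case False
  then have "sgn d \<bullet> sgn d = 1" by (simp add: dot_square_norm norm_sgn)
  then have "mixS d z \<bullet> sgn d = mixT (norm d) (z \<bullet> sgn d)"
    by (simp add: mixS_def inner_simps)
  moreover have "norm (mixS d z - z) = \<bar>mixT (norm d) (z \<bullet> sgn d) - z \<bullet> sgn d\<bar>"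
    using False by (simp add: mixS_def norm_sgn)
  ultimately show ?thesis using mixT_dist_small[of "norm d" "z \<bullet> sgn d"] by simp
qed (simp add: mixS_def)

text \<open>Resampling the component of z along d reduces the claim to
  \<open>nn_integral_mixT\<close> on each line parallel to d.\<close>

lemma nn_integral_mixS:
  fixes f :: "real ^ 'n \<Rightarrow> ennreal"
  assumes f [measurable]: "f \<in> borel_measurable borel"
  shows "(\<integral>\<^sup>+z. f (mixS d (z + d)) + f (mixS d (z - d)) \<partial>std_gaussian) = 2 * (\<integral>\<^sup>+z. f z \<partial>std_gaussian)"
proof (cases "d = 0")
  case True
  then show ?thesis by (simp add: mixS_def nn_integral_add mult_2)
next
  case False
  define e where "e = sgn d"
  define a where "a = norm d"
  have e: "norm e = 1" using False by (simp add: e_def norm_sgn)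
  then have ee: "e \<bullet> e = 1" by (simp add: dot_square_norm)
  have d: "d = a *\<^sub>R e" using False by (simp add: a_def e_def sgn_div_norm)
  have S: "mixS d (z + \<xi> *\<^sub>R e - (z \<bullet> e) *\<^sub>R e + t *\<^sub>R e) = z + mixT a (\<xi> + t) *\<^sub>R e - (z \<bullet> e) *\<^sub>R e" for z \<xi> t
    by (simp add: mixS_def inner_simps ee flip: a_def e_def) (simp add: algebra_simps)
  have "(\<integral>\<^sup>+z. f (mixS d (z + d)) + f (mixS d (z - d)) \<partial>std_gaussian)
    = (\<integral>\<^sup>+z. \<integral>\<^sup>+\<xi>. f (mixS d (z + \<xi> *\<^sub>R e - (z \<bullet> e) *\<^sub>R e + d)) + f (mixS d (z + \<xi> *\<^sub>R e - (z \<bullet> e) *\<^sub>R e - d)) \<partial>gauss1 \<partial>std_gaussian)"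
    by (rule nn_integral_std_gaussian_split[OF _ e, symmetric]) measurable
  also have "\<dots> = (\<integral>\<^sup>+z. \<integral>\<^sup>+\<xi>. f (z + mixT a (\<xi> + a) *\<^sub>R e - (z \<bullet> e) *\<^sub>R e) + f (z + mixT a (\<xi> - a) *\<^sub>R e - (z \<bullet> e) *\<^sub>R e) \<partial>gauss1 \<partial>std_gaussian)"
    using S[of _ _ a] S[of _ _ "- a"] by (simp add: d[symmetric])
  also have "\<dots> = (\<integral>\<^sup>+z. 2 * (\<integral>\<^sup>+\<xi>. f (z + \<xi> *\<^sub>R e - (z \<bullet> e) *\<^sub>R e) \<partial>gauss1) \<partial>std_gaussian)"
    by (intro nn_integral_cong nn_integral_mixT[where f = "\<lambda>y. f (_ + y *\<^sub>R e - _)"]) (auto simp: a_def)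
  also have "\<dots> = 2 * (\<integral>\<^sup>+z. f z \<partial>std_gaussian)"
    by (simp add: nn_integral_cmult nn_integral_std_gaussian_split[OF f e])
  finally show ?thesis .
qed

subsection \<open>Inequalities for powers and norms\<close>

lemma powr_le_self:
  fixes p w :: real
  assumes "1 \<le> p" "0 \<le> w" "w \<le> 1"
  shows "w powr p \<le> w"
  using powr_mono'[of 1 p w] assms by simp

text \<open>For positive x and y this is convexity of the power. If one of them is 0, what remains
  is w powr p \<le> w for the weight w of the other.\<close>

lemma powr_convex_nonneg:
  fixes p u v x y :: real
  assumes p: "1 \<le> p" and "0 \<le> u" "0 \<le> v" "u + v = 1" "0 \<le> x" "0 \<le> y"
  shows "(u * x + v * y) powr p \<le> u * x powr p + v * y powr p"
proof -
  have contract: "(w * z) powr p \<le> w * z powr p" if "0 \<le> w" "w \<le> 1" "0 \<le> z" for w z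
    using powr_le_self[OF p that(1,2)] by (simp add: powr_mult mult_right_mono)
  show ?thesis
  proof (cases "x = 0 \<or> y = 0")
    case True
    then show ?thesis using contract[of u x] contract[of v y] assms by auto
  next
    case False
    then show ?thesis
      using convex_onD[OF powr_convex[OF p], of v x y] assms
      by (simp add: eq_diff_eq[symmetric])
  qed
qed

text \<open>After division by a + b both terms lie in [0, 1], where t powr p \<le> t, and they sum
  to 1.\<close>

lemma powr_superadditive:
  fixes p a b :: real
  assumes p: "1 \<le> p" and "0 \<le> a" "0 \<le> b"
  shows "a powr p + b powr p \<le> (a + b) powr p"
proof (cases "a + b = 0")
  case False
  with assms have ab: "0 < a + b" by linarith
  have part: "c powr p \<le> (a + b) powr p * (c / (a + b))" if "0 \<le> c" "c \<le> a + b" for c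
  proof -
    have "(c / (a + b)) powr p \<le> c / (a + b)"
      using that ab by (intro powr_le_self[OF p]) auto
    then have "(a + b) powr p * (c / (a + b)) powr p \<le> (a + b) powr p * (c / (a + b))"
      using that ab by (intro mult_left_mono) auto
    then show ?thesis using that ab by (simp add: powr_divide)
  qed
  have "a powr p + b powr p \<le> (a + b) powr p * (a / (a + b)) + (a + b) powr p * (b / (a + b))"
    using part[of a] part[of b] assms by auto
  also have "\<dots> = (a + b) powr p"
    using ab by (simp flip: distrib_left add_divide_distrib)
  finally show ?thesis .
next
  case True
  with assms have "a = 0" "b = 0" by linarith+
  then show ?thesis by simp
qed

text \<open>With norms squared, superadditivity of the p-th power, the parallelogram identity and
  convexity of the p-th power apply in turn.\<close>

lemma clarkson_inequality:
  fixes x y :: "'a::real_inner"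
  assumes p: "1 \<le> p"
  shows "norm (x + y) powr (2 * p) + norm (x - y) powr (2 * p)
    \<le> 2 powr (2 * p - 1) * (norm x powr (2 * p) + norm y powr (2 * p))"
proof -
  have sq: "norm z powr (2 * p) = ((norm z)\<^sup>2) powr p" for z :: 'a
    by (simp add: powr_powr[symmetric])
  have "norm (x + y) powr (2 * p) + norm (x - y) powr (2 * p) \<le> ((norm (x + y))\<^sup>2 + (norm (x - y))\<^sup>2) powr p"
    unfolding sq by (rule powr_superadditive[OF p]) auto
  also have "(norm (x + y))\<^sup>2 + (norm (x - y))\<^sup>2 = 4 * (1/2 * (norm x)\<^sup>2 + 1/2 * (norm y)\<^sup>2)"
    by (simp add: power2_norm_eq_inner inner_simps inner_commute)
  also have "\<dots> powr p = 4 powr p * (1/2 * (norm x)\<^sup>2 + 1/2 * (norm y)\<^sup>2) powr p"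
    by (rule powr_mult)
  also have "\<dots> \<le> 4 powr p * (1/2 * ((norm x)\<^sup>2) powr p + 1/2 * ((norm y)\<^sup>2) powr p)"
    by (intro mult_left_mono powr_convex_nonneg[OF p]) auto
  also have "4 powr p = 2 * 2 powr (2 * p - 1)"
    by (simp add: powr_diff powr_powr[symmetric])
  finally show ?thesis by (simp only: sq) (simp add: algebra_simps)
qed

text \<open>For nonnegative f and A: the L^p-norm of f is at most A. The extended integral makes
  finiteness part of the statement, so no integrability has to be carried along.\<close>

definition Lp_le :: "real \<Rightarrow> 'a measure \<Rightarrow> ('a \<Rightarrow> real) \<Rightarrow> real \<Rightarrow> bool" where
  "Lp_le p M f A \<longleftrightarrow> (\<integral>\<^sup>+x. ennreal (f x powr p) \<partial>M) \<le> ennreal (A powr p)"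

lemma Lp_le_mono:
  assumes "Lp_le p M g A" "0 \<le> p" "\<And>x. x \<in> space M \<Longrightarrow> 0 \<le> f x" "\<And>x. x \<in> space M \<Longrightarrow> f x \<le> g x"
    "0 \<le> A" "A \<le> B"
  shows "Lp_le p M f B"
proof -
  have "(\<integral>\<^sup>+x. ennreal (f x powr p) \<partial>M) \<le> (\<integral>\<^sup>+x. ennreal (g x powr p) \<partial>M)"
    using assms by (intro nn_integral_mono ennreal_leI powr_mono2) auto
  also have "\<dots> \<le> ennreal (A powr p)" using assms(1) by (simp add: Lp_le_def)
  also have "\<dots> \<le> ennreal (B powr p)" using assms by (intro ennreal_leI powr_mono2) auto
  finally show ?thesis by (simp add: Lp_le_def)
qed

lemma Lp_le_zero_imp_AE:
  assumes "Lp_le p M f 0" "f \<in> borel_measurable M"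
  shows "AE x in M. f x = 0"
proof -
  have "(\<integral>\<^sup>+x. ennreal (f x powr p) \<partial>M) = 0" using assms(1) by (simp add: Lp_le_def)
  then have "AE x in M. ennreal (f x powr p) = 0"
    using assms(2) by (subst (asm) nn_integral_0_iff_AE) auto
  then show ?thesis by eventually_elim (auto simp: ennreal_eq_0_iff)
qed

lemma Lp_le_cong_AE:
  assumes "AE x in M. f x = g x" "Lp_le p M g A"
  shows "Lp_le p M f A"
proof -
  have "(\<integral>\<^sup>+x. ennreal (f x powr p) \<partial>M) = (\<integral>\<^sup>+x. ennreal (g x powr p) \<partial>M)"
    by (rule nn_integral_cong_AE) (use assms(1) in eventually_elim, simp)
  then show ?thesis using assms(2) by (simp add: Lp_le_def)
qed

text \<open>Convexity applied to f / A and g / B with weights A / (A + B) and B / (A + B). A zero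
  bound makes the corresponding function vanish almost everywhere and is treated separately.\<close>

lemma minkowski_inequality:
  assumes p: "1 \<le> p" and AB: "0 \<le> A" "0 \<le> B"
    and f: "Lp_le p M f A" "f \<in> borel_measurable M" "\<And>x. 0 \<le> f x"
    and g: "Lp_le p M g B" "g \<in> borel_measurable M" "\<And>x. 0 \<le> g x"
  shows "Lp_le p M (\<lambda>x. f x + g x) (A + B)"
proof -
  consider "A = 0" | "B = 0" | "0 < A" "0 < B" using AB by fastforce
  then show ?thesis
  proof cases
    case 1
    have "AE x in M. f x + g x = g x"
      using Lp_le_zero_imp_AE[of p M f] f 1 by auto
    then show ?thesis using Lp_le_cong_AE[OF _ g(1)] 1 by simp
  next
    case 2
    have "AE x in M. f x + g x = f x"
      using Lp_le_zero_imp_AE[of p M g] g 2 by auto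
    then show ?thesis using Lp_le_cong_AE[OF _ f(1)] 2 by simp
  next
    case 3
    note [measurable] = f(2) g(2)
    define c where "c = (A + B) powr p"
    define u where "u = A / (A + B)"
    define v where "v = B / (A + B)"
    have uv: "0 \<le> u" "0 \<le> v" "u + v = 1" "A + B \<noteq> 0" "0 \<le> c"
      using 3 by (auto simp: u_def v_def c_def simp flip: add_divide_distrib)
    have pt: "(f x + g x) powr p \<le> c * u / A powr p * f x powr p + c * v / B powr p * g x powr p" for x
    proof -
      have "f x + g x = (A + B) * (u * (f x / A) + v * (g x / B))"
        using 3 uv(4) by (simp add: u_def v_def distrib_left)
      then have "(f x + g x) powr p = c * (u * (f x / A) + v * (g x / B)) powr p"
        by (simp add: c_def powr_mult)
      also have "\<dots> \<le> c * (u * (f x / A) powr p + v * (g x / B) powr p)"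
        using uv 3 f(3) g(3) by (intro mult_left_mono powr_convex_nonneg[OF p]) auto
      also have "\<dots> = c * u / A powr p * f x powr p + c * v / B powr p * g x powr p"
        using 3 f(3) g(3) by (simp add: powr_divide algebra_simps)
      finally show ?thesis .
    qed
    have "(\<integral>\<^sup>+x. ennreal ((f x + g x) powr p) \<partial>M)
      \<le> (\<integral>\<^sup>+x. ennreal (c * u / A powr p) * ennreal (f x powr p) + ennreal (c * v / B powr p) * ennreal (g x powr p) \<partial>M)"
      using uv pt by (intro nn_integral_mono) (simp flip: ennreal_mult ennreal_plus)
    also have "\<dots> = ennreal (c * u / A powr p) * (\<integral>\<^sup>+x. ennreal (f x powr p) \<partial>M)
      + ennreal (c * v / B powr p) * (\<integral>\<^sup>+x. ennreal (g x powr p) \<partial>M)"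
      by (simp add: nn_integral_add nn_integral_cmult)
    also have "\<dots> \<le> ennreal (c * u / A powr p) * ennreal (A powr p) + ennreal (c * v / B powr p) * ennreal (B powr p)"
      using f(1) g(1) by (intro add_mono mult_left_mono) (auto simp: Lp_le_def)
    also have "\<dots> = ennreal (c * u + c * v)"
      using uv 3 by (simp flip: ennreal_mult ennreal_plus)
    also have "c * u + c * v = (A + B) powr p" using uv by (simp add: c_def flip: distrib_left)
    finally show ?thesis by (simp add: Lp_le_def)
  qed
qed

lemma Lp_le_const:
  assumes "prob_space M" "0 \<le> c"
  shows "Lp_le p M (\<lambda>_. c) c"
  using prob_space.emeasure_space_1[OF assms(1)] by (simp add: Lp_le_def)

lemma Lp_le_scale:
  assumes "Lp_le p M f A" "f \<in> borel_measurable M" "0 \<le> c" "\<And>x. 0 \<le> f x" "0 \<le> A"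
  shows "Lp_le p M (\<lambda>x. c * f x) (c * A)"
proof -
  have "(\<integral>\<^sup>+x. ennreal ((c * f x) powr p) \<partial>M) = ennreal (c powr p) * (\<integral>\<^sup>+x. ennreal (f x powr p) \<partial>M)"
    using assms by (simp add: powr_mult ennreal_mult nn_integral_cmult)
  also have "\<dots> \<le> ennreal (c powr p) * ennreal (A powr p)"
    using assms(1) by (intro mult_left_mono) (auto simp: Lp_le_def)
  finally show ?thesis using assms by (simp add: Lp_le_def powr_mult ennreal_mult)
qed

text \<open>Jensen's inequality for x = E (x - Y), where Y has law \<mu>. The case of an infinite
  right side is split off to have integrability.\<close>

lemma norm_le_Lp_norm_minus:
  fixes \<mu> :: "'a::euclidean_space measure"
  assumes q: "1 < q" and "prob_space \<mu>" and [measurable_cong]: "sets \<mu> = sets borel"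
    and mean: "(\<integral>y. y \<partial>\<mu>) = 0" and int: "integrable \<mu> (\<lambda>y. y)"
  shows "ennreal (norm x powr q) \<le> (\<integral>\<^sup>+y. ennreal (norm (x - y) powr q) \<partial>\<mu>)"
proof (cases "x = 0 \<or> (\<integral>\<^sup>+y. ennreal (norm (x - y) powr q) \<partial>\<mu>) = \<infinity>")
  case True
  then show ?thesis by auto
next
  case False
  interpret prob_space \<mu> by fact
  define b where "b = norm x"
  have b: "0 < b" using False by (simp add: b_def)
  have intq: "integrable \<mu> (\<lambda>y. norm (x - y) powr q)"
    using False by (intro integrableI_bounded) (auto simp: top.not_eq_extremum)
  have intd: "integrable \<mu> (\<lambda>y. norm (x - y))"
    using int by auto
  have "x = (\<integral>y. x - y \<partial>\<mu>)"
    using int mean by (simp add: prob_space)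
  then have "b \<le> (\<integral>y. norm (x - y) \<partial>\<mu>)"
    unfolding b_def using integral_norm_bound[of \<mu> "\<lambda>y. x - y"] by simp
  then have "b * b powr (q - 1) \<le> (\<integral>y. norm (x - y) \<partial>\<mu>) * b powr (q - 1)"
    by (intro mult_right_mono) auto
  also have "b * b powr (q - 1) = b powr q" using b powr_add[of b 1 "q - 1"] by simp
  also have "(\<integral>y. norm (x - y) \<partial>\<mu>) * b powr (q - 1) = (\<integral>y. norm (x - y) * b powr (q - 1) \<partial>\<mu>)"
    by simp
  also have "\<dots> \<le> (\<integral>y. norm (x - y) powr q / q + (1 - 1 / q) * b powr q \<partial>\<mu>)"
  proof (rule integral_mono)
    fix y
    \<comment> \<open>Young's inequality with exponents q and q / (q - 1) is the tangent line bound
      for t^q at t = b = |x|.\<close>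
    have "norm (x - y) * b powr (q - 1) \<le> norm (x - y) powr q / q + (b powr (q - 1)) powr (q / (q - 1)) / (q / (q - 1))"
      using q by (intro Youngs_inequality) (auto simp: field_simps)
    also have "(b powr (q - 1)) powr (q / (q - 1)) / (q / (q - 1)) = (1 - 1 / q) * b powr q"
    proof -
      have "(q - 1) * (q / (q - 1)) = q" using q by simp
      then show ?thesis using q by (simp only: powr_powr) (simp add: field_simps)
    qed
    finally show "norm (x - y) * b powr (q - 1) \<le> norm (x - y) powr q / q + (1 - 1 / q) * b powr q" .
  qed (use intd intq in auto)
  also have "\<dots> = (\<integral>y. norm (x - y) powr q \<partial>\<mu>) / q + (1 - 1 / q) * b powr q"
    using intq by (simp add: prob_space)
  finally have "b powr q / q \<le> (\<integral>y. norm (x - y) powr q \<partial>\<mu>) / q"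
    by (simp add: algebra_simps)
  then have "b powr q \<le> (\<integral>y. norm (x - y) powr q \<partial>\<mu>)"
    using q by (simp add: divide_le_cancel)
  then show ?thesis
    unfolding b_def by (subst nn_integral_eq_integral[OF intq]) auto
qed

subsection \<open>Averaging independent copies\<close>

definition moment :: "real \<Rightarrow> 'a::euclidean_space measure \<Rightarrow> real" where
  "moment q \<mu> = (\<integral>x. norm x powr q \<partial>\<mu>)"

text \<open>The invariant of the iteration. For q \<ge> 1 the finite moment makes the identity
  integrable (\<open>centered_integrable_id\<close>), so the mean 0 is not the default value of a
  divergent Bochner integral.\<close>

definition centered :: "real \<Rightarrow> 'a::euclidean_space measure \<Rightarrow> bool" where
  "centered q \<mu> \<longleftrightarrow> prob_space \<mu> \<and> sets \<mu> = sets borel \<and> (\<integral>x. x \<partial>\<mu>) = 0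
     \<and> integrable \<mu> (\<lambda>x. norm x powr q)"

definition midpoint_law :: "'a::euclidean_space measure \<Rightarrow> 'a measure" where
  "midpoint_law \<mu> = distr (\<mu> \<Otimes>\<^sub>M \<mu>) borel (\<lambda>(x, y). midpoint x y)"

lemma borel_measurable_midpoint [measurable]:
  fixes f g :: "'b \<Rightarrow> 'a::euclidean_space"
  assumes [measurable]: "f \<in> borel_measurable M" "g \<in> borel_measurable M"
  shows "(\<lambda>x. midpoint (f x) (g x)) \<in> borel_measurable M"
  unfolding midpoint_def by measurable

lemma moment_nonneg: "0 \<le> moment q \<mu>"
  by (simp add: moment_def)

lemma nn_integral_eq_moment:
  assumes "centered q \<mu>"
  shows "(\<integral>\<^sup>+x. ennreal (norm x powr q) \<partial>\<mu>) = ennreal (moment q \<mu>)"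
  unfolding moment_def using assms by (intro nn_integral_eq_integral) (auto simp: centered_def)

lemma centered_integrable_id:
  assumes q: "1 \<le> q" and \<mu>: "centered q \<mu>"
  shows "integrable \<mu> (\<lambda>x. x)"
proof -
  interpret prob_space \<mu> using \<mu> by (simp add: centered_def)
  have [measurable_cong]: "sets \<mu> = sets borel" using \<mu> by (simp add: centered_def)
  show ?thesis
  proof (rule Bochner_Integration.integrable_bound)
    show "integrable \<mu> (\<lambda>x. 1 + norm x powr q)" using \<mu> by (auto simp: centered_def)
    show "AE x in \<mu>. norm x \<le> norm (1 + norm x powr q)"
    proof (rule AE_I2)
      fix x :: 'a
      show "norm x \<le> norm (1 + norm x powr q)"
      proof (cases "norm x \<le> 1")
        case True
        then show ?thesis by (simp add: add_increasing2)
      next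
        case False
        then have "norm x \<le> norm x powr q" using q powr_mono[of 1 q "norm x"] by simp
        then show ?thesis by simp
      qed
    qed
  qed measurable
qed

text \<open>Clarkson's inequality for two independent copies. Dropping the first term bounds the
  cost of a step; bounding the second from below contracts the moment.\<close>

lemma nn_integral_norm_add_diff:
  assumes p: "1 \<le> p" and \<mu>: "centered (2 * p) \<mu>"
  shows "(\<integral>\<^sup>+x. \<integral>\<^sup>+y. ennreal (norm (x + y) powr (2 * p)) \<partial>\<mu> \<partial>\<mu>)
      + (\<integral>\<^sup>+x. \<integral>\<^sup>+y. ennreal (norm (x - y) powr (2 * p)) \<partial>\<mu> \<partial>\<mu>)
    \<le> ennreal (2 powr (2 * p) * moment (2 * p) \<mu>)"
proof -
  interpret prob_space \<mu> using \<mu> by (simp add: centered_def)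
  have [measurable_cong]: "sets \<mu> = sets borel" using \<mu> by (simp add: centered_def)
  note m = nn_integral_eq_moment[OF \<mu>]
  have "(\<integral>\<^sup>+x. \<integral>\<^sup>+y. ennreal (norm (x + y) powr (2 * p)) \<partial>\<mu> \<partial>\<mu>)
      + (\<integral>\<^sup>+x. \<integral>\<^sup>+y. ennreal (norm (x - y) powr (2 * p)) \<partial>\<mu> \<partial>\<mu>)
    = (\<integral>\<^sup>+x. \<integral>\<^sup>+y. ennreal (norm (x + y) powr (2 * p) + norm (x - y) powr (2 * p)) \<partial>\<mu> \<partial>\<mu>)"
    by (simp add: nn_integral_add ennreal_plus)
  also have "\<dots> \<le> (\<integral>\<^sup>+x. \<integral>\<^sup>+y. ennreal (2 powr (2 * p - 1) * (norm x powr (2 * p) + norm y powr (2 * p))) \<partial>\<mu> \<partial>\<mu>)"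
    by (intro nn_integral_mono ennreal_leI clarkson_inequality p)
  also have "\<dots> = ennreal (2 powr (2 * p - 1)) * (ennreal (moment (2 * p) \<mu>) + ennreal (moment (2 * p) \<mu>))"
    by (simp add: ennreal_mult ennreal_plus nn_integral_cmult nn_integral_add m emeasure_space_1)
  also have "\<dots> = ennreal (2 powr (2 * p - 1) * (moment (2 * p) \<mu> + moment (2 * p) \<mu>))"
    using moment_nonneg[of "2 * p" \<mu>] by (simp only: ennreal_plus[symmetric] ennreal_mult powr_ge_zero add_nonneg_nonneg)
  also have "2 powr (2 * p - 1) * (moment (2 * p) \<mu> + moment (2 * p) \<mu>) = 2 powr (2 * p) * moment (2 * p) \<mu>"
    by (simp add: powr_diff)
  finally show ?thesis .
qed

lemma nn_integral_norm_diff_half: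
  assumes p: "1 \<le> p" and \<mu>: "centered (2 * p) \<mu>"
  shows "(\<integral>\<^sup>+x. \<integral>\<^sup>+y. ennreal (norm ((1/2) *\<^sub>R (x - y)) powr (2 * p)) \<partial>\<mu> \<partial>\<mu>) \<le> ennreal (moment (2 * p) \<mu>)"
proof -
  have [measurable_cong]: "sets \<mu> = sets borel" using \<mu> by (simp add: centered_def)
  interpret prob_space \<mu> using \<mu> by (simp add: centered_def)
  have "(\<integral>\<^sup>+x. \<integral>\<^sup>+y. ennreal (norm ((1/2) *\<^sub>R (x - y)) powr (2 * p)) \<partial>\<mu> \<partial>\<mu>)
    = (\<integral>\<^sup>+x. \<integral>\<^sup>+y. ennreal ((1/2) powr (2 * p)) * ennreal (norm (x - y) powr (2 * p)) \<partial>\<mu> \<partial>\<mu>)"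
    unfolding norm_scaleR by (simp only: powr_mult) (simp add: ennreal_mult)
  also have "\<dots> = ennreal ((1/2) powr (2 * p)) * (\<integral>\<^sup>+x. \<integral>\<^sup>+y. ennreal (norm (x - y) powr (2 * p)) \<partial>\<mu> \<partial>\<mu>)"
    by (simp add: nn_integral_cmult)
  also have "\<dots> \<le> ennreal ((1/2) powr (2 * p)) * ennreal (2 powr (2 * p) * moment (2 * p) \<mu>)"
    using nn_integral_norm_add_diff[OF p \<mu>] by (intro mult_left_mono) (auto elim: order_trans[rotated])
  also have "\<dots> = ennreal (moment (2 * p) \<mu>)"
    by (subst ennreal_mult[symmetric]) (auto simp: moment_nonneg powr_divide)
  finally show ?thesis .
qed

lemma (in pair_prob_space) distr_pair_snd: "distr (M1 \<Otimes>\<^sub>M M2) M2 snd = M2"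
proof (rule measure_eqI)
  fix A assume "A \<in> sets (distr (M1 \<Otimes>\<^sub>M M2) M2 snd)"
  then have A: "A \<in> sets M2" by simp
  then have "snd -` A \<inter> space (M1 \<Otimes>\<^sub>M M2) = space M1 \<times> A"
    using sets.sets_into_space by (auto simp: space_pair_measure)
  then show "emeasure (distr (M1 \<Otimes>\<^sub>M M2) M2 snd) A = emeasure M2 A"
    using A by (simp add: emeasure_distr M2.emeasure_pair_measure_Times M1.emeasure_space_1)
qed simp

text \<open>With c = 2^(2p) and m the moment of \<mu>, the sum X + X' has moment at most c m - m,
  and halving the sum divides it by c.\<close>

lemma midpoint_law_moment:
  assumes p: "1 \<le> p" and \<mu>: "centered (2 * p) \<mu>"
  shows "centered (2 * p) (midpoint_law \<mu>)" (is ?centered)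
    and "moment (2 * p) (midpoint_law \<mu>) \<le> (1 - 2 powr (- 2 * p)) * moment (2 * p) \<mu>" (is ?moment)
proof -
  define m where "m = moment (2 * p) \<mu>"
  define c :: real where "c = 2 powr (2 * p)"
  have "2 powr 1 \<le> c" unfolding c_def using p by (intro powr_mono) auto
  then have c: "1 \<le> c" "(1/2) powr (2 * p) = 1 / c" "2 powr (- 2 * p) = 1 / c"
    by (simp_all add: c_def powr_divide powr_minus_divide)
  interpret \<mu>: prob_space \<mu> using \<mu> by (simp add: centered_def)
  interpret pair_prob_space \<mu> \<mu> ..
  have sets: "sets \<mu> = sets borel" and mean: "(\<integral>x. x \<partial>\<mu>) = 0" using \<mu> by (simp_all add: centered_def)
  note [measurable_cong] = sets
  have int: "integrable \<mu> (\<lambda>x. x)" using p by (intro centered_integrable_id[OF _ \<mu>]) simp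
  have meas: "(\<lambda>(x, y). midpoint x y) \<in> borel_measurable (\<mu> \<Otimes>\<^sub>M \<mu>)"
    unfolding case_prod_beta by measurable
  have "(\<integral>\<^sup>+x. ennreal (norm x powr (2 * p)) \<partial>midpoint_law \<mu>)
    = (\<integral>\<^sup>+z. ennreal (norm (midpoint (fst z) (snd z)) powr (2 * p)) \<partial>(\<mu> \<Otimes>\<^sub>M \<mu>))"
    unfolding midpoint_law_def by (subst nn_integral_distr[OF meas]) (auto simp: case_prod_beta)
  also have "\<dots> = (\<integral>\<^sup>+x. \<integral>\<^sup>+y. ennreal (norm (midpoint x y) powr (2 * p)) \<partial>\<mu> \<partial>\<mu>)"
    by (subst \<mu>.nn_integral_fst[symmetric]) auto
  also have "\<dots> = (\<integral>\<^sup>+x. \<integral>\<^sup>+y. ennreal ((1/2) powr (2 * p)) * ennreal (norm (x + y) powr (2 * p)) \<partial>\<mu> \<partial>\<mu>)"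
    unfolding midpoint_def norm_scaleR by (simp only: powr_mult) (simp add: ennreal_mult)
  also have "\<dots> = ennreal (1 / c) * (\<integral>\<^sup>+x. \<integral>\<^sup>+y. ennreal (norm (x + y) powr (2 * p)) \<partial>\<mu> \<partial>\<mu>)"
    by (simp add: nn_integral_cmult c(2))
  also have "\<dots> \<le> ennreal (1 / c) * ennreal (c * m - m)"
  proof (rule mult_left_mono)
    \<comment> \<open>Jensen for each fixed x, then integration over x. Finiteness of m allows the
      subtraction.\<close>
    have "ennreal m \<le> (\<integral>\<^sup>+x. \<integral>\<^sup>+y. ennreal (norm (x - y) powr (2 * p)) \<partial>\<mu> \<partial>\<mu>)"
      unfolding m_def nn_integral_eq_moment[OF \<mu>, symmetric]
      using p by (intro nn_integral_mono norm_le_Lp_norm_minus sets mean int) (auto simp: \<mu>.prob_space_axioms)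
    then have "(\<integral>\<^sup>+x. \<integral>\<^sup>+y. ennreal (norm (x + y) powr (2 * p)) \<partial>\<mu> \<partial>\<mu>) + ennreal m \<le> ennreal (c * m)"
      unfolding c_def m_def by (intro order_trans[OF add_left_mono nn_integral_norm_add_diff[OF p \<mu>]])
    then show "(\<integral>\<^sup>+x. \<integral>\<^sup>+y. ennreal (norm (x + y) powr (2 * p)) \<partial>\<mu> \<partial>\<mu>) \<le> ennreal (c * m - m)"
      by (simp add: ennreal_le_minus_iff moment_nonneg m_def flip: ennreal_minus)
  qed simp
  also have "\<dots> = ennreal ((1 - 1 / c) * m)"
    using c(1) mult_right_mono[OF c(1) moment_nonneg[of "2 * p" \<mu>]]
    by (subst ennreal_mult[symmetric]) (auto simp: m_def field_simps)
  finally have le: "(\<integral>\<^sup>+x. ennreal (norm x powr (2 * p)) \<partial>midpoint_law \<mu>) \<le> ennreal ((1 - 1 / c) * m)" .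
  have prob: "prob_space (midpoint_law \<mu>)"
    unfolding midpoint_law_def by (rule prob_space_distr[OF meas])
  have s: "sets (midpoint_law \<mu>) = sets borel" by (simp add: midpoint_law_def)
  have fst: "distr (\<mu> \<Otimes>\<^sub>M \<mu>) \<mu> fst = \<mu>" by (rule \<mu>.distr_pair_fst)
  have snd: "distr (\<mu> \<Otimes>\<^sub>M \<mu>) \<mu> snd = \<mu>" by (rule distr_pair_snd)
  have intp: "integrable (\<mu> \<Otimes>\<^sub>M \<mu>) fst" "integrable (\<mu> \<Otimes>\<^sub>M \<mu>) snd"
    using integrable_distr_eq[of fst "\<mu> \<Otimes>\<^sub>M \<mu>" \<mu> "\<lambda>x. x"] integrable_distr_eq[of snd "\<mu> \<Otimes>\<^sub>M \<mu>" \<mu> "\<lambda>x. x"] int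
    by (simp_all add: fst snd)
  have intf: "(\<integral>z. fst z \<partial>(\<mu> \<Otimes>\<^sub>M \<mu>)) = 0" "(\<integral>z. snd z \<partial>(\<mu> \<Otimes>\<^sub>M \<mu>)) = 0"
    using integral_distr[of fst "\<mu> \<Otimes>\<^sub>M \<mu>" \<mu> "\<lambda>x. x"] integral_distr[of snd "\<mu> \<Otimes>\<^sub>M \<mu>" \<mu> "\<lambda>x. x"] mean
    by (simp_all add: fst snd)
  have mean': "(\<integral>x. x \<partial>midpoint_law \<mu>) = 0"
    unfolding midpoint_law_def
    by (subst integral_distr[OF meas]) (simp_all add: case_prod_unfold midpoint_def intp intf)
  have int': "integrable (midpoint_law \<mu>) (\<lambda>x. norm x powr (2 * p))"
    using le_less_trans[OF le] by (intro integrableI_bounded) (auto simp: measurable_cong_sets[OF s])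
  show cent: ?centered unfolding centered_def using prob s mean' int' by simp
  have "ennreal (moment (2 * p) (midpoint_law \<mu>)) \<le> ennreal ((1 - 1 / c) * m)"
    using le nn_integral_eq_moment[OF cent] by simp
  then show ?moment
    using c(1,3) moment_nonneg[of "2 * p" \<mu>]
    by (subst (asm) ennreal_le_iff) (auto simp: m_def)
qed

subsection \<open>Cost of one averaging step\<close>

text \<open>Once the component along e is resampled, F sees only the new variable.\<close>

lemma nn_integral_std_gaussian_inner:
  fixes e :: "real ^ 'n"
  assumes [measurable]: "F \<in> borel_measurable borel" and e: "norm e = 1"
  shows "(\<integral>\<^sup>+z. F (z \<bullet> e) \<partial>std_gaussian) = (\<integral>\<^sup>+\<xi>. F \<xi> \<partial>gauss1)"
proof -
  interpret prob_space "std_gaussian :: (real ^ 'n) measure" by (rule prob_space_std_gaussian)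
  have "e \<bullet> e = 1" using e by (simp add: dot_square_norm)
  then have "(z + \<xi> *\<^sub>R e - (z \<bullet> e) *\<^sub>R e) \<bullet> e = \<xi>" for z \<xi> by (simp add: inner_simps)
  then have "(\<integral>\<^sup>+z. F (z \<bullet> e) \<partial>std_gaussian) = (\<integral>\<^sup>+z. \<integral>\<^sup>+\<xi>. F \<xi> \<partial>gauss1 \<partial>(std_gaussian :: (real ^ 'n) measure))"
    by (subst nn_integral_std_gaussian_split[OF _ e, symmetric]) simp_all
  then show ?thesis using emeasure_space_1 by simp
qed

text \<open>Domination by 1 + |\<xi>|^k with a natural number k \<ge> p reduces real exponents to
  integer moments.\<close>

lemma integrable_gauss1_powr:
  assumes "0 \<le> p"
  shows "integrable gauss1 (\<lambda>\<xi>. \<bar>\<xi>\<bar> powr p)"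
proof -
  obtain k :: nat where k: "p \<le> real k" using real_arch_simple by blast
  have "integrable lborel (\<lambda>\<xi>. std_normal_density \<xi> * 1 + std_normal_density \<xi> * \<bar>\<xi>\<bar> ^ k)"
    by (intro Bochner_Integration.integrable_add integrable_std_normal_moment_abs) simp
  then have "integrable lborel (\<lambda>\<xi>. std_normal_density \<xi> * (1 + \<bar>\<xi>\<bar> ^ k))"
    by (simp add: distrib_left)
  then have bnd: "integrable gauss1 (\<lambda>\<xi>. 1 + \<bar>\<xi>\<bar> ^ k)"
    unfolding gauss1_def by (subst integrable_real_density) (auto simp: mult.commute)
  show ?thesis
  proof (rule Bochner_Integration.integrable_bound[OF bnd])
    show "AE \<xi> in gauss1. norm (\<bar>\<xi>\<bar> powr p) \<le> norm (1 + \<bar>\<xi>\<bar> ^ k)"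
    proof (rule AE_I2)
      fix \<xi> :: real
      show "norm (\<bar>\<xi>\<bar> powr p) \<le> norm (1 + \<bar>\<xi>\<bar> ^ k)"
      proof (cases "\<bar>\<xi>\<bar> \<le> 1")
        case True
        then have "\<bar>\<xi>\<bar> powr p \<le> 1" using assms powr_le1 by auto
        then show ?thesis by (simp add: add_increasing2)
      next
        case False
        then have "\<bar>\<xi>\<bar> powr p \<le> \<bar>\<xi>\<bar> powr real k" using k by (intro powr_mono) auto
        also have "\<dots> = \<bar>\<xi>\<bar> ^ k" using False by (simp add: powr_realpow)
        finally show ?thesis by simp
      qed
    qed
  qed measurable
qed

lemma C_const_nonneg: "0 \<le> C_const p"
  by (simp add: C_const_def)

lemma Lp_le_C_const:
  assumes "0 < p"
  shows "Lp_le p gauss1 (\<lambda>\<xi>. \<bar>\<xi>\<bar>) (C_const p)"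
  using assms integrable_gauss1_powr[of p]
  unfolding Lp_le_def by (subst nn_integral_eq_integral) (auto simp: C_const_def powr_powr gauss1_def)

lemma K_const_ge_1: "1 \<le> K_const p"
  by (simp add: K_const_def)

text \<open>The origin of \<open>K_const\<close>. If |d| \<ge> 1, the displacement is at most |d|
  \<le> |d|^2. If |d| \<le> 1, Minkowski applies to \<open>mixS_dist_small\<close>, and |d|^3 \<le>
  |d|^2 absorbs the cubic term.\<close>

lemma mixS_cost:
  fixes d :: "real ^ 'n"
  assumes p: "1 \<le> p"
  shows "(\<integral>\<^sup>+z. ennreal (norm (mixS d (z + d) - (z + d)) powr p)
      + ennreal (norm (mixS d (z - d) - (z - d)) powr p) \<partial>std_gaussian)
    \<le> 2 * ennreal ((K_const p * (norm d)\<^sup>2) powr p)"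
proof -
  interpret G: prob_space "std_gaussian :: (real ^ 'n) measure" by (rule prob_space_std_gaussian)
  define a where "a = norm d"
  consider "d = 0" | "1 \<le> a" | "0 < a" "a \<le> 1" "d \<noteq> 0" unfolding a_def by fastforce
  then show ?thesis
  proof cases
    case 1
    then show ?thesis by (simp add: mixS_def)
  next
    case 2
    have "a \<le> K_const p * a\<^sup>2"
      using mult_mono[OF K_const_ge_1[of p] self_le_power[OF 2, of 2]] 2 K_const_ge_1[of p] by simp
    then have "norm (mixS d z - z) powr p \<le> (K_const p * a\<^sup>2) powr p" for z
      using mixS_dist[of d z] p unfolding a_def by (intro powr_mono2) auto
    then have "(\<integral>\<^sup>+z. ennreal (norm (mixS d (z + d) - (z + d)) powr p)
      + ennreal (norm (mixS d (z - d) - (z - d)) powr p) \<partial>std_gaussian)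
      \<le> (\<integral>\<^sup>+z. ennreal ((K_const p * a\<^sup>2) powr p) + ennreal ((K_const p * a\<^sup>2) powr p) \<partial>(std_gaussian :: (real ^ 'n) measure))"
      by (intro nn_integral_mono add_mono ennreal_leI)
    then show ?thesis by (simp add: G.emeasure_space_1 a_def mult_2 del: space_std_gaussian)
  next
    case 3
    define e where "e = sgn d"
    have e: "norm e = 1" using 3 by (simp add: e_def norm_sgn)
    define F where "F s = ennreal ((a\<^sup>2 / 2 * \<bar>s\<bar> + a ^ 3 / 3) powr p)" for s
    have [measurable]: "F \<in> borel_measurable borel" unfolding F_def[abs_def] by measurable
    have "ennreal (norm (mixS d z - z) powr p) \<le> F (mixS d z \<bullet> e)" for z
      using mixS_dist_small[of d z] p unfolding F_def a_def e_def
      by (intro ennreal_leI powr_mono2) auto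
    then have "(\<integral>\<^sup>+z. ennreal (norm (mixS d (z + d) - (z + d)) powr p)
      + ennreal (norm (mixS d (z - d) - (z - d)) powr p) \<partial>std_gaussian)
      \<le> (\<integral>\<^sup>+z. F (mixS d (z + d) \<bullet> e) + F (mixS d (z - d) \<bullet> e) \<partial>std_gaussian)"
      by (intro nn_integral_mono add_mono)
    \<comment> \<open>The bound involves only the transported point, so the mixture can be exchanged
      for its Gaussian image.\<close>
    also have "\<dots> = 2 * (\<integral>\<^sup>+z. F (z \<bullet> e) \<partial>std_gaussian)"
      by (rule nn_integral_mixS) measurable
    also have "\<dots> = 2 * (\<integral>\<^sup>+\<xi>. F \<xi> \<partial>gauss1)"
      by (simp add: nn_integral_std_gaussian_inner[OF _ e])
    also have "\<dots> \<le> 2 * ennreal ((K_const p * a\<^sup>2) powr p)"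
    proof (rule mult_left_mono)
      have "Lp_le p gauss1 (\<lambda>\<xi>. a\<^sup>2 / 2 * \<bar>\<xi>\<bar> + a ^ 3 / 3) (a\<^sup>2 / 2 * C_const p + a ^ 3 / 3)"
        using p 3 C_const_nonneg[of p]
        by (intro minkowski_inequality Lp_le_scale Lp_le_C_const Lp_le_const) (auto simp: gauss1.prob_space_axioms)
      moreover have "a\<^sup>2 / 2 * C_const p + a ^ 3 / 3 \<le> K_const p * a\<^sup>2"
      proof -
        have "a ^ 3 \<le> a\<^sup>2" using 3 by (intro power_decreasing) auto
        then have "a\<^sup>2 / 2 * C_const p + a ^ 3 / 3 \<le> (C_const p / 2 + 1 / 3) * a\<^sup>2"
          by (simp add: algebra_simps)
        also have "\<dots> \<le> K_const p * a\<^sup>2"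
          by (intro mult_right_mono) (auto simp: K_const_def)
        finally show ?thesis .
      qed
      ultimately have "Lp_le p gauss1 (\<lambda>\<xi>. a\<^sup>2 / 2 * \<bar>\<xi>\<bar> + a ^ 3 / 3) (K_const p * a\<^sup>2)"
        using p 3 C_const_nonneg[of p] by (elim Lp_le_mono) auto
      then show "(\<integral>\<^sup>+\<xi>. F \<xi> \<partial>gauss1) \<le> ennreal ((K_const p * a\<^sup>2) powr p)"
        by (simp add: Lp_le_def F_def)
    qed simp
    finally show ?thesis by (simp add: a_def)
  qed
qed

lemma nn_integral_pair_sym:
  assumes "sigma_finite_measure \<mu>" and [measurable]: "\<Psi> \<in> borel_measurable (\<mu> \<Otimes>\<^sub>M \<mu>)"
  shows "(\<integral>\<^sup>+x. \<integral>\<^sup>+y. \<Psi> (x, y) + \<Psi> (y, x) \<partial>\<mu> \<partial>\<mu>) = 2 * (\<integral>\<^sup>+x. \<integral>\<^sup>+y. \<Psi> (x, y) \<partial>\<mu> \<partial>\<mu>)"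
proof -
  interpret sigma_finite_measure \<mu> by fact
  interpret pair_sigma_finite \<mu> \<mu> ..
  have "(\<integral>\<^sup>+x. \<integral>\<^sup>+y. \<Psi> (y, x) \<partial>\<mu> \<partial>\<mu>) = (\<integral>\<^sup>+x. \<integral>\<^sup>+y. \<Psi> (x, y) \<partial>\<mu> \<partial>\<mu>)"
    by (rule Fubini) measurable
  moreover have "(\<integral>\<^sup>+x. \<integral>\<^sup>+y. \<Psi> (x, y) + \<Psi> (y, x) \<partial>\<mu> \<partial>\<mu>)
      = (\<integral>\<^sup>+x. (\<integral>\<^sup>+y. \<Psi> (x, y) \<partial>\<mu>) + (\<integral>\<^sup>+y. \<Psi> (y, x) \<partial>\<mu>) \<partial>\<mu>)"
    by (intro nn_integral_cong nn_integral_add) measurable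
  moreover have "\<dots> = (\<integral>\<^sup>+x. \<integral>\<^sup>+y. \<Psi> (x, y) \<partial>\<mu> \<partial>\<mu>) + (\<integral>\<^sup>+x. \<integral>\<^sup>+y. \<Psi> (y, x) \<partial>\<mu> \<partial>\<mu>)"
    by (rule nn_integral_add) measurable
  ultimately show ?thesis by (simp add: mult_2)
qed

subsection \<open>Iterated couplings\<close>

text \<open>The coupling keeps the pair \<open>(x, g)\<close> instead of the sum \<open>x + g\<close>, so that the next averaging step
  can act on \<open>x\<close> and \<open>g\<close> and no gluing of couplings is needed.\<close>

definition noisy_coupling ::
  "real \<Rightarrow> (real ^ 'n) measure \<Rightarrow> (real ^ 'n) measure \<Rightarrow> real \<Rightarrow>
    ((real ^ 'n) \<times> (real ^ 'n) \<times> (real ^ 'n)) measure \<Rightarrow> bool" where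
  "noisy_coupling p \<mu>\<^sub>0 \<mu> A Q \<longleftrightarrow> prob_space Q \<and> sets Q = sets (borel \<Otimes>\<^sub>M (borel \<Otimes>\<^sub>M borel)) \<and>
     distr Q borel fst = (\<mu>\<^sub>0 \<star> std_gaussian) \<and>
     distr Q (borel \<Otimes>\<^sub>M borel) snd = \<mu> \<Otimes>\<^sub>M std_gaussian \<and>
     Lp_le p Q (\<lambda>(y, x, g). norm (y - (x + g))) A"

lemma noisy_coupling_self:
  fixes \<mu> :: "(real ^ 'n) measure"
  assumes "prob_space \<mu>" and sets: "sets \<mu> = sets borel"
  shows "\<exists>Q. noisy_coupling p \<mu> \<mu> 0 Q"
proof -
  interpret \<mu>: prob_space \<mu> by fact
  interpret G: prob_space "std_gaussian :: (real ^ 'n) measure" by (rule prob_space_std_gaussian)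
  interpret pair_prob_space \<mu> "std_gaussian :: (real ^ 'n) measure" ..
  note [measurable_cong] = sets
  define Q where "Q = distr (\<mu> \<Otimes>\<^sub>M (std_gaussian :: (real ^ 'n) measure))
     (borel \<Otimes>\<^sub>M (borel \<Otimes>\<^sub>M borel)) (\<lambda>(x, g). (x + g, x, g))"
  have [measurable]: "(\<lambda>(x, g). (x + g, x, g)) \<in> measurable (\<mu> \<Otimes>\<^sub>M (std_gaussian :: (real ^ 'n) measure))
     (borel \<Otimes>\<^sub>M (borel \<Otimes>\<^sub>M borel))"
    unfolding case_prod_beta by measurable
  have "noisy_coupling p \<mu> \<mu> 0 Q"
    unfolding noisy_coupling_def
  proof (intro conjI)
    show "prob_space Q" unfolding Q_def by (rule prob_space_distr) measurable
    show "sets Q = sets (borel \<Otimes>\<^sub>M (borel \<Otimes>\<^sub>M borel))" by (simp add: Q_def)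
    show "distr Q borel fst = (\<mu> \<star> std_gaussian)"
      unfolding Q_def convolution_def by (subst distr_distr) (auto simp: comp_def case_prod_unfold)
    have "distr Q (borel \<Otimes>\<^sub>M borel) snd = distr (\<mu> \<Otimes>\<^sub>M std_gaussian) (borel \<Otimes>\<^sub>M borel) (\<lambda>x. x)"
      unfolding Q_def by (subst distr_distr) (auto simp: comp_def case_prod_beta)
    also have "\<dots> = \<mu> \<Otimes>\<^sub>M std_gaussian"
      by (rule distr_id2) (simp add: sets cong: sets_pair_measure_cong)
    finally show "distr Q (borel \<Otimes>\<^sub>M borel) snd = \<mu> \<Otimes>\<^sub>M std_gaussian" .
    have "(\<integral>\<^sup>+x. ennreal ((case x of (y, x, g) \<Rightarrow> norm (y - (x + g))) powr p) \<partial>Q)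
      = (\<integral>\<^sup>+x. 0 \<partial>(\<mu> \<Otimes>\<^sub>M (std_gaussian :: (real ^ 'n) measure)))"
      unfolding Q_def by (subst nn_integral_distr) (auto simp: case_prod_beta)
    then show "Lp_le p Q (\<lambda>(y, x, g). norm (y - (x + g))) 0" by (simp add: Lp_le_def)
  qed
  then show ?thesis by blast
qed

definition half_diff :: "'a::real_vector \<Rightarrow> 'a \<Rightarrow> 'a" where
  "half_diff x y = (1/2) *\<^sub>R (x - y)"

lemma half_diff_commute: "half_diff y x = - half_diff x y"
  by (simp add: half_diff_def algebra_simps)

lemma midpoint_half_diff: "midpoint x y + half_diff x y = x" for x y :: "'a::real_vector"
proof -
  have "midpoint x y + half_diff x y = (1/2 + 1/2) *\<^sub>R x"
    unfolding midpoint_def half_diff_def by (simp only: scaleR_add_left) (simp add: algebra_simps)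
  then show ?thesis by simp
qed

lemma borel_measurable_half_diff [measurable]:
  fixes f g :: "'b \<Rightarrow> 'a::euclidean_space"
  assumes [measurable]: "f \<in> borel_measurable M" "g \<in> borel_measurable M"
  shows "(\<lambda>x. half_diff (f x) (g x)) \<in> borel_measurable M"
  unfolding half_diff_def by measurable

text \<open>Conditioning on the unordered pair without conditional laws: exchanging x and x' fixes
  the midpoint and negates the half-difference, and h is even in the latter. So averaging over the
  exchange yields both shifts of g.\<close>

lemma nn_integral_resample:
  fixes \<mu> :: "(real ^ 'n) measure" and h :: "(real ^ 'n) \<times> (real ^ 'n) \<times> (real ^ 'n) \<Rightarrow> ennreal"
  assumes "prob_space \<mu>" and sets [measurable_cong]: "sets \<mu> = sets borel"
    and h [measurable]: "h \<in> borel_measurable (borel \<Otimes>\<^sub>M (borel \<Otimes>\<^sub>M borel))"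
    and sym: "\<And>m d w. h (m, - d, w) = h (m, d, w)"
  shows "2 * (\<integral>\<^sup>+x. \<integral>\<^sup>+g. \<integral>\<^sup>+x'. h (midpoint x x', half_diff x x', half_diff x x' + g) \<partial>\<mu> \<partial>std_gaussian \<partial>\<mu>)
    = (\<integral>\<^sup>+x. \<integral>\<^sup>+x'. \<integral>\<^sup>+g. h (midpoint x x', half_diff x x', g + half_diff x x')
        + h (midpoint x x', half_diff x x', g - half_diff x x') \<partial>std_gaussian \<partial>\<mu> \<partial>\<mu>)"
proof -
  interpret \<mu>: prob_space \<mu> by fact
  interpret G: prob_space "std_gaussian :: (real ^ 'n) measure" by (rule prob_space_std_gaussian)
  interpret pair_sigma_finite \<mu> "std_gaussian :: (real ^ 'n) measure" ..
  define \<Psi> where "\<Psi> = (\<lambda>(x, x'). \<integral>\<^sup>+g. h (midpoint x x', half_diff x x', g + half_diff x x') \<partial>std_gaussian)"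
  have [measurable]: "\<Psi> \<in> borel_measurable (\<mu> \<Otimes>\<^sub>M \<mu>)"
    unfolding \<Psi>_def case_prod_beta by measurable
  have "(\<integral>\<^sup>+g. \<integral>\<^sup>+x'. h (midpoint x x', half_diff x x', half_diff x x' + g) \<partial>\<mu> \<partial>std_gaussian)
    = (\<integral>\<^sup>+x'. \<Psi> (x, x') \<partial>\<mu>)" for x
    unfolding \<Psi>_def prod.case add.commute[of "half_diff _ _"] by (rule Fubini') measurable
  then have "2 * (\<integral>\<^sup>+x. \<integral>\<^sup>+g. \<integral>\<^sup>+x'. h (midpoint x x', half_diff x x', half_diff x x' + g) \<partial>\<mu> \<partial>std_gaussian \<partial>\<mu>)
    = (\<integral>\<^sup>+x. \<integral>\<^sup>+x'. \<Psi> (x, x') + \<Psi> (x', x) \<partial>\<mu> \<partial>\<mu>)"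
    by (simp add: nn_integral_pair_sym[OF \<mu>.sigma_finite_measure_axioms])
  also have "\<dots> = (\<integral>\<^sup>+x. \<integral>\<^sup>+x'. \<integral>\<^sup>+g. h (midpoint x x', half_diff x x', g + half_diff x x')
        + h (midpoint x x', half_diff x x', g - half_diff x x') \<partial>std_gaussian \<partial>\<mu> \<partial>\<mu>)"
  proof (intro nn_integral_cong)
    fix x x' :: "real ^ 'n"
    have "\<Psi> (x', x) = (\<integral>\<^sup>+g. h (midpoint x x', half_diff x x', g - half_diff x x') \<partial>std_gaussian)"
      unfolding \<Psi>_def by (simp add: midpoint_sym[of x' x] half_diff_commute[of x' x] sym)
    then show "\<Psi> (x, x') + \<Psi> (x', x) = (\<integral>\<^sup>+g. h (midpoint x x', half_diff x x', g + half_diff x x')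
        + h (midpoint x x', half_diff x x', g - half_diff x x') \<partial>std_gaussian)"
      unfolding \<Psi>_def by (simp add: nn_integral_add)
  qed
  finally show ?thesis .
qed

text \<open>Draw an independent copy x' and write x + g = m + w with w = d + g. The new triple is
  (y, m, \<open>mixS d w\<close>): given m and d up to sign, w is the mixture, so its image is
  Gaussian and independent of m. The extra error is the displacement of w.\<close>

lemma noisy_coupling_step:
  fixes \<mu> :: "(real ^ 'n) measure"
  assumes p: "1 \<le> p" and \<mu>: "centered (2 * p) \<mu>" and A: "0 \<le> A"
    and Q: "noisy_coupling p \<mu>\<^sub>0 \<mu> A Q"
  shows "\<exists>Q'. noisy_coupling p \<mu>\<^sub>0 (midpoint_law \<mu>) (A + K_const p * moment (2 * p) \<mu> powr (1 / p)) Q'"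
proof -
  have prob: "prob_space \<mu>" and sets: "sets \<mu> = sets borel" using \<mu> by (auto simp: centered_def)
  interpret \<mu>: prob_space \<mu> by fact
  interpret Q: prob_space Q using Q by (simp add: noisy_coupling_def)
  interpret R: pair_prob_space Q \<mu> ..
  interpret G: prob_space "std_gaussian :: (real ^ 'n) measure" by (rule prob_space_std_gaussian)
  interpret \<mu>G: pair_prob_space \<mu> "std_gaussian :: (real ^ 'n) measure" ..
  interpret \<mu>\<mu>: pair_prob_space \<mu> \<mu> ..
  interpret M: prob_space "midpoint_law \<mu>"
    using midpoint_law_moment(1)[OF p \<mu>] by (simp add: centered_def)
  have Qsets: "sets Q = sets (borel \<Otimes>\<^sub>M (borel \<Otimes>\<^sub>M borel))"
    and Qsnd: "distr Q (borel \<Otimes>\<^sub>M borel) snd = \<mu> \<Otimes>\<^sub>M std_gaussian"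
    and Qfst: "distr Q borel fst = (\<mu>\<^sub>0 \<star> std_gaussian)"
    and QLp: "Lp_le p Q (\<lambda>(y, x, g). norm (y - (x + g))) A"
    using Q by (auto simp: noisy_coupling_def)
  have Msets: "sets (midpoint_law \<mu>) = sets borel" by (simp add: midpoint_law_def)
  note [measurable_cong] = sets Qsets Msets
  let ?x = "\<lambda>\<omega>. fst (snd (fst \<omega>))" and ?g = "\<lambda>\<omega>. snd (snd (fst \<omega>))"
  define m where "m \<omega> = midpoint (?x \<omega>) (snd \<omega>)"
    for \<omega> :: "((real ^ 'n) \<times> (real ^ 'n) \<times> (real ^ 'n)) \<times> (real ^ 'n)"
  define d where "d \<omega> = half_diff (?x \<omega>) (snd \<omega>)"
    for \<omega> :: "((real ^ 'n) \<times> (real ^ 'n) \<times> (real ^ 'n)) \<times> (real ^ 'n)"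
  define w where "w \<omega> = d \<omega> + ?g \<omega>"
    for \<omega> :: "((real ^ 'n) \<times> (real ^ 'n) \<times> (real ^ 'n)) \<times> (real ^ 'n)"
  have [measurable]: "m \<in> borel_measurable (Q \<Otimes>\<^sub>M \<mu>)" "d \<in> borel_measurable (Q \<Otimes>\<^sub>M \<mu>)" "w \<in> borel_measurable (Q \<Otimes>\<^sub>M \<mu>)"
    unfolding m_def[abs_def] d_def[abs_def] w_def[abs_def] by measurable
  define S where "S \<omega> = (fst (fst \<omega>), m \<omega>, mixS (d \<omega>) (w \<omega>))" for \<omega>
  have S [measurable]: "S \<in> measurable (Q \<Otimes>\<^sub>M \<mu>) (borel \<Otimes>\<^sub>M (borel \<Otimes>\<^sub>M borel))"
    unfolding S_def[abs_def] by measurable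
  define Q' where "Q' = distr (Q \<Otimes>\<^sub>M \<mu>) (borel \<Otimes>\<^sub>M (borel \<Otimes>\<^sub>M borel)) S"
  have R_int: "2 * (\<integral>\<^sup>+\<omega>. h (m \<omega>, d \<omega>, w \<omega>) \<partial>(Q \<Otimes>\<^sub>M \<mu>))
     = (\<integral>\<^sup>+x. \<integral>\<^sup>+x'. \<integral>\<^sup>+g. h (midpoint x x', half_diff x x', g + half_diff x x')
        + h (midpoint x x', half_diff x x', g - half_diff x x') \<partial>std_gaussian \<partial>\<mu> \<partial>\<mu>)"
    if h [measurable]: "h \<in> borel_measurable (borel \<Otimes>\<^sub>M (borel \<Otimes>\<^sub>M borel))"
      and sym: "\<And>m d w. h (m, - d, w) = h (m, d, w)" for h
  proof -
    define H where "H z = (\<integral>\<^sup>+x'. h (midpoint (fst z) x', half_diff (fst z) x', half_diff (fst z) x' + snd z) \<partial>\<mu>)" for z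
    have [measurable]: "H \<in> borel_measurable (borel \<Otimes>\<^sub>M borel)"
      unfolding H_def[abs_def] by measurable
    have "(\<integral>\<^sup>+\<omega>. h (m \<omega>, d \<omega>, w \<omega>) \<partial>(Q \<Otimes>\<^sub>M \<mu>)) = (\<integral>\<^sup>+q. H (snd q) \<partial>Q)"
      by (subst \<mu>.nn_integral_fst[symmetric]) (auto simp: m_def d_def w_def H_def)
    also have "\<dots> = (\<integral>\<^sup>+z. H z \<partial>(\<mu> \<Otimes>\<^sub>M std_gaussian))"
      unfolding Qsnd[symmetric] by (subst nn_integral_distr) auto
    also have "\<dots> = (\<integral>\<^sup>+x. \<integral>\<^sup>+g. H (x, g) \<partial>std_gaussian \<partial>\<mu>)"
      by (rule G.nn_integral_fst[symmetric]) measurable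
    finally show ?thesis
      using nn_integral_resample[OF prob sets h sym] by (simp add: H_def)
  qed
  have fst: "distr Q' borel fst = (\<mu>\<^sub>0 \<star> std_gaussian)"
  proof -
    have "distr Q' borel fst = distr (Q \<Otimes>\<^sub>M \<mu>) borel (fst \<circ> fst)"
      unfolding Q'_def by (subst distr_distr) (auto simp: comp_def S_def)
    also have "\<dots> = distr (distr (Q \<Otimes>\<^sub>M \<mu>) Q fst) borel fst"
      by (subst distr_distr) auto
    also have "\<dots> = (\<mu>\<^sub>0 \<star> std_gaussian)" by (simp add: \<mu>.distr_pair_fst Qfst)
    finally show ?thesis .
  qed
  have snd: "distr Q' (borel \<Otimes>\<^sub>M borel) snd = midpoint_law \<mu> \<Otimes>\<^sub>M std_gaussian"
  \<comment> \<open>The computation is done for twice the measure, as the mixture appears with total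
    weight 2; the factor is cancelled at the end.\<close>
  proof (rule measure_eqI)
    show "sets (distr Q' (borel \<Otimes>\<^sub>M borel) snd) = sets (midpoint_law \<mu> \<Otimes>\<^sub>M std_gaussian)"
      by (simp add: Msets cong: sets_pair_measure_cong)
    fix B assume "B \<in> sets (distr Q' (borel \<Otimes>\<^sub>M borel) snd)"
    then have B [measurable]: "B \<in> sets (borel \<Otimes>\<^sub>M borel)" by simp
    have B' [measurable]: "B \<in> sets (midpoint_law \<mu> \<Otimes>\<^sub>M std_gaussian)"
      using B by (simp add: Msets cong: sets_pair_measure_cong)
    define k :: "(real ^ 'n) \<times> (real ^ 'n) \<Rightarrow> ennreal" where "k = indicator B"
    have k [measurable]: "k \<in> borel_measurable (borel \<Otimes>\<^sub>M borel)" unfolding k_def by measurable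
    have "2 * emeasure (distr Q' (borel \<Otimes>\<^sub>M borel) snd) B = 2 * (\<integral>\<^sup>+z. k z \<partial>distr Q' (borel \<Otimes>\<^sub>M borel) snd)"
      by (simp add: k_def)
    also have "\<dots> = 2 * (\<integral>\<^sup>+\<omega>. k (m \<omega>, mixS (d \<omega>) (w \<omega>)) \<partial>(Q \<Otimes>\<^sub>M \<mu>))"
      unfolding Q'_def by (subst nn_integral_distr, simp, simp, subst nn_integral_distr) (simp_all add: S_def)
    also have "\<dots> = (\<integral>\<^sup>+x. \<integral>\<^sup>+x'. \<integral>\<^sup>+g. k (midpoint x x', mixS (half_diff x x') (g + half_diff x x'))
        + k (midpoint x x', mixS (half_diff x x') (g - half_diff x x')) \<partial>std_gaussian \<partial>\<mu> \<partial>\<mu>)"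
      by (rule R_int[of "\<lambda>(m, d, w). k (m, mixS d w)", unfolded prod.case]) (simp_all add: mixS_minus case_prod_beta)
    also have "\<dots> = (\<integral>\<^sup>+x. \<integral>\<^sup>+x'. 2 * (\<integral>\<^sup>+g. k (midpoint x x', g) \<partial>std_gaussian) \<partial>\<mu> \<partial>\<mu>)"
      by (intro nn_integral_cong nn_integral_mixS[where f = "\<lambda>z. k (_, z)"]) measurable
    also have "\<dots> = 2 * (\<integral>\<^sup>+x. \<integral>\<^sup>+x'. \<integral>\<^sup>+g. k (midpoint x x', g) \<partial>std_gaussian \<partial>\<mu> \<partial>\<mu>)"
      by (simp add: nn_integral_cmult)
    also have "(\<integral>\<^sup>+x. \<integral>\<^sup>+x'. \<integral>\<^sup>+g. k (midpoint x x', g) \<partial>std_gaussian \<partial>\<mu> \<partial>\<mu>)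
      = (\<integral>\<^sup>+z. \<integral>\<^sup>+g. k (midpoint (fst z) (snd z), g) \<partial>std_gaussian \<partial>(\<mu> \<Otimes>\<^sub>M \<mu>))"
      by (subst \<mu>.nn_integral_fst[symmetric]) auto
    also have "\<dots> = (\<integral>\<^sup>+y. \<integral>\<^sup>+g. k (y, g) \<partial>std_gaussian \<partial>midpoint_law \<mu>)"
      unfolding midpoint_law_def by (subst nn_integral_distr) (auto simp: case_prod_beta)
    also have "\<dots> = (\<integral>\<^sup>+z. k z \<partial>(midpoint_law \<mu> \<Otimes>\<^sub>M std_gaussian))"
      by (rule G.nn_integral_fst) (simp add: k_def)
    also have "\<dots> = emeasure (midpoint_law \<mu> \<Otimes>\<^sub>M std_gaussian) B"
      by (simp add: k_def)
    finally show "emeasure (distr Q' (borel \<Otimes>\<^sub>M borel) snd) B = emeasure (midpoint_law \<mu> \<Otimes>\<^sub>M std_gaussian) B"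
      by (simp add: ennreal_mult_cancel_left)
  qed
  have cost: "Lp_le p (Q \<Otimes>\<^sub>M \<mu>) (\<lambda>\<omega>. norm (mixS (d \<omega>) (w \<omega>) - w \<omega>)) (K_const p * moment (2 * p) \<mu> powr (1 / p))"
  proof -
    have "2 * (\<integral>\<^sup>+\<omega>. ennreal (norm (mixS (d \<omega>) (w \<omega>) - w \<omega>) powr p) \<partial>(Q \<Otimes>\<^sub>M \<mu>))
      = (\<integral>\<^sup>+x. \<integral>\<^sup>+x'. \<integral>\<^sup>+g. ennreal (norm (mixS (half_diff x x') (g + half_diff x x') - (g + half_diff x x')) powr p)
        + ennreal (norm (mixS (half_diff x x') (g - half_diff x x') - (g - half_diff x x')) powr p) \<partial>std_gaussian \<partial>\<mu> \<partial>\<mu>)"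
      by (rule R_int[of "\<lambda>(m, d, w). ennreal (norm (mixS d w - w) powr p)", unfolded prod.case]) (simp_all add: mixS_minus case_prod_beta)
    also have "\<dots> \<le> (\<integral>\<^sup>+x. \<integral>\<^sup>+x'. 2 * ennreal ((K_const p * (norm (half_diff x x'))\<^sup>2) powr p) \<partial>\<mu> \<partial>\<mu>)"
      by (intro nn_integral_mono mixS_cost p)
    \<comment> \<open>The p-th power of the quadratic cost is where the 2p-th moment of the
      half-difference appears.\<close>
    also have "\<dots> = (\<integral>\<^sup>+x. \<integral>\<^sup>+x'. 2 * ennreal (K_const p powr p) * ennreal (norm ((1/2) *\<^sub>R (x - x')) powr (2 * p)) \<partial>\<mu> \<partial>\<mu>)"
      using K_const_ge_1[of p] unfolding half_diff_def
      by (intro nn_integral_cong) (simp only: powr_mult ennreal_mult powr_ge_zero powr_powr[symmetric] powr_numeral norm_ge_zero mult.assoc)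
    also have "\<dots> = 2 * ennreal (K_const p powr p) * (\<integral>\<^sup>+x. \<integral>\<^sup>+x'. ennreal (norm ((1/2) *\<^sub>R (x - x')) powr (2 * p)) \<partial>\<mu> \<partial>\<mu>)"
      by (simp add: nn_integral_cmult)
    also have "\<dots> \<le> 2 * ennreal (K_const p powr p) * ennreal (moment (2 * p) \<mu>)"
      by (intro mult_left_mono nn_integral_norm_diff_half[OF p \<mu>]) simp
    also have "\<dots> = 2 * ennreal ((K_const p * moment (2 * p) \<mu> powr (1 / p)) powr p)"
      using p K_const_ge_1[of p] moment_nonneg[of "2 * p" \<mu>]
      by (simp add: powr_mult powr_powr ennreal_mult mult.assoc)
    finally show ?thesis
      by (simp add: Lp_le_def ennreal_mult_le_mult_iff)
  qed
  have old: "Lp_le p (Q \<Otimes>\<^sub>M \<mu>) (\<lambda>\<omega>. norm (fst (fst \<omega>) - (m \<omega> + w \<omega>))) A"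
  proof -
    have eq: "m \<omega> + w \<omega> = ?x \<omega> + ?g \<omega>" for \<omega>
      using midpoint_half_diff[of "?x \<omega>" "snd \<omega>"] unfolding m_def w_def d_def by (simp add: add.assoc[symmetric])
    have "(\<integral>\<^sup>+\<omega>. ennreal (norm (fst (fst \<omega>) - (m \<omega> + w \<omega>)) powr p) \<partial>(Q \<Otimes>\<^sub>M \<mu>))
      = (\<integral>\<^sup>+q. \<integral>\<^sup>+x'. ennreal (norm (fst q - (fst (snd q) + snd (snd q))) powr p) \<partial>\<mu> \<partial>Q)"
      unfolding eq by (subst \<mu>.nn_integral_fst[symmetric]) auto
    then show ?thesis
      using QLp by (simp add: Lp_le_def case_prod_beta \<mu>.emeasure_space_1)
  qed
  have "Lp_le p (Q \<Otimes>\<^sub>M \<mu>) (\<lambda>\<omega>. norm (fst (fst \<omega>) - (m \<omega> + w \<omega>)) + norm (mixS (d \<omega>) (w \<omega>) - w \<omega>))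
    (A + K_const p * moment (2 * p) \<mu> powr (1 / p))"
    using A p K_const_ge_1[of p] by (intro minkowski_inequality old cost) auto
  then have "Lp_le p (Q \<Otimes>\<^sub>M \<mu>) (\<lambda>\<omega>. norm (fst (fst \<omega>) - (m \<omega> + mixS (d \<omega>) (w \<omega>))))
    (A + K_const p * moment (2 * p) \<mu> powr (1 / p))"
  proof (rule Lp_le_mono)
    fix \<omega>
    have "fst (fst \<omega>) - (m \<omega> + mixS (d \<omega>) (w \<omega>)) = (fst (fst \<omega>) - (m \<omega> + w \<omega>)) - (mixS (d \<omega>) (w \<omega>) - w \<omega>)"
      by simp
    then show "norm (fst (fst \<omega>) - (m \<omega> + mixS (d \<omega>) (w \<omega>)))
      \<le> norm (fst (fst \<omega>) - (m \<omega> + w \<omega>)) + norm (mixS (d \<omega>) (w \<omega>) - w \<omega>)"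
      using norm_triangle_ineq4 by metis
  qed (use p A K_const_ge_1[of p] in auto)
  then have "Lp_le p Q' (\<lambda>(y, x, g). norm (y - (x + g))) (A + K_const p * moment (2 * p) \<mu> powr (1 / p))"
    unfolding Lp_le_def Q'_def by (subst nn_integral_distr) (auto simp: case_prod_beta S_def)
  moreover have "prob_space Q'" unfolding Q'_def by (rule R.prob_space_distr) measurable
  moreover have "sets Q' = sets (borel \<Otimes>\<^sub>M (borel \<Otimes>\<^sub>M borel))" by (simp add: Q'_def)
  ultimately show ?thesis unfolding noisy_coupling_def using fst snd by blast
qed

text \<open>In place of Cauchy-Schwarz: t \<le> c / 2 + t^2 / (2 c) for t = |x|^p and c = e^p. This
  choice of c makes the two halves add up to e^p.\<close>

lemma Lp_le_sqrt_moment: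
  assumes \<mu>: "centered (2 * p) \<mu>" and e: "0 < e" and m: "moment (2 * p) \<mu> \<le> e powr (2 * p)"
  shows "Lp_le p \<mu> norm e"
proof -
  interpret prob_space \<mu> using \<mu> by (simp add: centered_def)
  have [measurable_cong]: "sets \<mu> = sets borel" using \<mu> by (simp add: centered_def)
  define c where "c = e powr p"
  have c: "0 < c" "e powr (2 * p) = c * c"
    using e powr_add[of e p p] by (simp_all add: c_def)
  have "(\<integral>\<^sup>+x. ennreal (norm x powr p) \<partial>\<mu>) \<le> (\<integral>\<^sup>+x. ennreal (c / 2) + ennreal (1 / (2 * c)) * ennreal (norm x powr (2 * p)) \<partial>\<mu>)"
  proof (rule nn_integral_mono)
    fix x
    have sq: "norm x powr (2 * p) = (norm x powr p)\<^sup>2" using powr_add[of "norm x" p p] by (simp add: power2_eq_square)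
    have "0 \<le> (norm x powr p - c)\<^sup>2" by simp
    then have "norm x powr p \<le> c / 2 + 1 / (2 * c) * norm x powr (2 * p)"
      unfolding sq using c(1) by (simp add: field_simps power2_eq_square)
    then have "ennreal (norm x powr p) \<le> ennreal (c / 2 + 1 / (2 * c) * norm x powr (2 * p))"
      by (rule ennreal_leI)
    also have "\<dots> = ennreal (c / 2) + ennreal (1 / (2 * c)) * ennreal (norm x powr (2 * p))"
      using c(1) by (simp flip: ennreal_mult ennreal_plus)
    finally show "ennreal (norm x powr p) \<le> ennreal (c / 2) + ennreal (1 / (2 * c)) * ennreal (norm x powr (2 * p))" .
  qed
  also have "\<dots> = ennreal (c / 2) + ennreal (1 / (2 * c)) * ennreal (moment (2 * p) \<mu>)"
    by (simp add: nn_integral_add nn_integral_cmult nn_integral_eq_moment[OF \<mu>] emeasure_space_1)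
  also have "\<dots> \<le> ennreal (c / 2) + ennreal (1 / (2 * c)) * ennreal (c * c)"
    using m c by (intro add_left_mono mult_left_mono ennreal_leI) auto
  also have "\<dots> = ennreal (e powr p)"
    using c(1) by (simp add: c_def flip: ennreal_mult ennreal_plus)
  finally show ?thesis by (simp add: Lp_le_def)
qed

text \<open>Forgetting x leaves a coupling of y with g, and |y - g| \<le> |y - (x + g)| +
  |x|.\<close>

lemma noisy_coupling_imp_transport_cost:
  fixes \<mu> :: "(real ^ 'n) measure"
  assumes p: "1 \<le> p" and \<mu>: "centered (2 * p) \<mu>" and A: "0 \<le> A" and e: "0 < e"
    and m: "moment (2 * p) \<mu> \<le> e powr (2 * p)"
    and Q: "noisy_coupling p \<mu>\<^sub>0 \<mu> A Q"
  shows "(INF \<tau>\<in>couplings (\<mu>\<^sub>0 \<star> std_gaussian) std_gaussian. \<integral>\<^sup>+ z. ennreal (norm (fst z - snd z) powr p) \<partial>\<tau>)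
    \<le> ennreal ((A + e) powr p)"
proof -
  have sets: "sets \<mu> = sets borel" using \<mu> by (simp add: centered_def)
  have Qsets: "sets Q = sets (borel \<Otimes>\<^sub>M (borel \<Otimes>\<^sub>M borel))"
    and Qsnd: "distr Q (borel \<Otimes>\<^sub>M borel) snd = \<mu> \<Otimes>\<^sub>M std_gaussian"
    and Qfst: "distr Q borel fst = (\<mu>\<^sub>0 \<star> std_gaussian)"
    and QLp: "Lp_le p Q (\<lambda>(y, x, g). norm (y - (x + g))) A"
    using Q by (auto simp: noisy_coupling_def)
  interpret \<mu>: prob_space \<mu> using \<mu> by (simp add: centered_def)
  interpret G: prob_space "std_gaussian :: (real ^ 'n) measure" by (rule prob_space_std_gaussian)
  interpret pair_prob_space \<mu> "std_gaussian :: (real ^ 'n) measure" ..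
  note [measurable_cong] = sets Qsets
  define \<tau> where "\<tau> = distr Q (borel \<Otimes>\<^sub>M borel) (\<lambda>\<omega>. (fst \<omega>, snd (snd \<omega>)))"
  have [measurable]: "(\<lambda>\<omega>. (fst \<omega>, snd (snd \<omega>))) \<in> measurable Q (borel \<Otimes>\<^sub>M borel)" by measurable
  have \<tau>: "\<tau> \<in> couplings (\<mu>\<^sub>0 \<star> std_gaussian) std_gaussian"
  proof -
    have "sets \<tau> = sets ((\<mu>\<^sub>0 \<star> std_gaussian) \<Otimes>\<^sub>M (std_gaussian :: (real ^ 'n) measure))"
      by (simp add: \<tau>_def cong: sets_pair_measure_cong)
    moreover have "distr \<tau> (\<mu>\<^sub>0 \<star> std_gaussian) fst = (\<mu>\<^sub>0 \<star> std_gaussian)"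
    proof -
      have "distr \<tau> (\<mu>\<^sub>0 \<star> std_gaussian) fst = distr \<tau> borel fst"
        by (rule distr_cong) auto
      also have "\<dots> = distr Q borel fst"
        unfolding \<tau>_def by (subst distr_distr) (auto simp: comp_def)
      finally show ?thesis by (simp add: Qfst)
    qed
    moreover have "distr \<tau> std_gaussian snd = std_gaussian"
    proof -
      have "distr \<tau> std_gaussian snd = distr Q std_gaussian (\<lambda>\<omega>. snd (snd \<omega>))"
        unfolding \<tau>_def by (subst distr_distr) (auto simp: comp_def)
      also have "\<dots> = distr (distr Q (borel \<Otimes>\<^sub>M borel) snd) std_gaussian snd"
        by (subst distr_distr) (auto simp: comp_def)
      also have "\<dots> = std_gaussian" unfolding Qsnd by (rule distr_pair_snd)
      finally show ?thesis .
    qed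
    ultimately show ?thesis by (simp add: couplings_def)
  qed
  have "Lp_le p Q (\<lambda>\<omega>. norm (fst (snd \<omega>))) e"
  proof -
    have "(\<integral>\<^sup>+\<omega>. ennreal (norm (fst (snd \<omega>)) powr p) \<partial>Q)
      = (\<integral>\<^sup>+z. ennreal (norm (fst z) powr p) \<partial>(\<mu> \<Otimes>\<^sub>M (std_gaussian :: (real ^ 'n) measure)))"
      unfolding Qsnd[symmetric] by (subst nn_integral_distr) auto
    also have "\<dots> = (\<integral>\<^sup>+x. ennreal (norm x powr p) \<partial>\<mu>)"
      using G.emeasure_space_1 by (subst G.nn_integral_fst[symmetric]) auto
    finally show ?thesis using Lp_le_sqrt_moment[OF \<mu> e m] by (simp add: Lp_le_def)
  qed
  moreover have "Lp_le p Q (\<lambda>\<omega>. norm (fst \<omega> - (fst (snd \<omega>) + snd (snd \<omega>)))) A"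
    using QLp by (simp add: case_prod_unfold)
  ultimately have "Lp_le p Q (\<lambda>\<omega>. norm (fst \<omega> - (fst (snd \<omega>) + snd (snd \<omega>))) + norm (fst (snd \<omega>))) (A + e)"
    using p A e by (intro minkowski_inequality) auto
  then have "Lp_le p Q (\<lambda>\<omega>. norm (fst \<omega> - snd (snd \<omega>))) (A + e)"
  proof (rule Lp_le_mono)
    fix \<omega> :: "(real ^ 'n) \<times> (real ^ 'n) \<times> (real ^ 'n)"
    have "fst \<omega> - snd (snd \<omega>) = (fst \<omega> - (fst (snd \<omega>) + snd (snd \<omega>))) + fst (snd \<omega>)"
      by (simp add: algebra_simps)
    then show "norm (fst \<omega> - snd (snd \<omega>)) \<le> norm (fst \<omega> - (fst (snd \<omega>) + snd (snd \<omega>))) + norm (fst (snd \<omega>))"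
      using norm_triangle_ineq by metis
  qed (use p A e in auto)
  then have "(\<integral>\<^sup>+ z. ennreal (norm (fst z - snd z) powr p) \<partial>\<tau>) \<le> ennreal ((A + e) powr p)"
    unfolding \<tau>_def Lp_le_def by (subst nn_integral_distr) auto
  then show ?thesis by (intro INF_lower2[OF \<tau>])
qed

text \<open>After the p-th root the bound is B + e, so e can be sent to 0; the case e = 1 already
  shows that x is finite.\<close>

lemma ennreal_powr_le_limit:
  assumes p: "0 < p" and B: "0 \<le> B" and x: "\<And>e. 0 < e \<Longrightarrow> x \<le> ennreal ((B + e) powr p)"
  shows "ennreal_powr x (1 / p) \<le> ennreal B"
proof -
  have fin: "x \<noteq> \<infinity>" using x[of 1] by (auto simp: top_unique)
  have "enn2real x powr (1 / p) \<le> B"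
  proof (rule field_le_epsilon)
    fix e :: real assume e: "0 < e"
    have "enn2real x \<le> (B + e) powr p"
      using x[OF e] enn2real_mono[of x "ennreal ((B + e) powr p)"] by simp
    then have "enn2real x powr (1 / p) \<le> ((B + e) powr p) powr (1 / p)"
      using p by (intro powr_mono2) auto
    also have "\<dots> = B + e" using p B e by (simp add: powr_powr)
    finally show "enn2real x powr (1 / p) \<le> B + e" .
  qed
  then show ?thesis using fin by (auto simp: ennreal_powr_def intro: ennreal_leI)
qed

theorem theorem2p1:
  fixes p :: real and \<mu> :: "(real ^ 'n) measure"
  assumes "p \<ge> 1"
    and "prob_space \<mu>"
    and "sets \<mu> = sets borel"
    and "(\<integral>x. x \<partial>\<mu>) = 0"
    and "integrable \<mu> (\<lambda>x. norm x powr (2 * p))"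
  shows "wasserstein p (\<mu> \<star> std_gaussian) std_gaussian
         \<le> ennreal (K_const p / (1 - (1 - 2 powr (- 2 * p)) powr (1 / p))
                     * (\<integral>x. norm x powr (2 * p) \<partial>\<mu>) powr (1 / p))"
proof -
  define \<theta> where "\<theta> = 1 - 2 powr (- 2 * p)"
  \<comment> \<open>\<theta> contracts the moments; the costs are their p-th roots, so r is the
    ratio of the series.\<close>
  define r where "r = \<theta> powr (1 / p)"
  define \<nu> where "\<nu> n = (midpoint_law ^^ n) \<mu>" for n
  define M where "M = moment (2 * p) \<mu>"
  define B where "B = K_const p / (1 - r) * M powr (1 / p)"
  have "2 powr (- 2 * p) < 2 powr 0" using assms(1) by (intro powr_less_mono) auto
  then have \<theta>: "0 < \<theta>" "\<theta> < 1" by (simp_all add: \<theta>_def)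
  have "r < 1 powr (1 / p)" unfolding r_def using \<theta> assms(1) by (intro powr_less_mono2) auto
  then have r: "0 \<le> r" "r < 1" by (simp_all add: r_def)
  have K: "1 \<le> K_const p" by (rule K_const_ge_1)
  have M: "0 \<le> M" by (simp add: M_def moment_nonneg)
  have B: "0 \<le> B" using r K M by (simp add: B_def)
  have \<nu>: "centered (2 * p) (\<nu> n) \<and> moment (2 * p) (\<nu> n) \<le> \<theta> ^ n * M" for n
  proof (induction n)
    case 0
    then show ?case using assms by (simp add: \<nu>_def centered_def M_def)
  next
    case (Suc n)
    have "moment (2 * p) (\<nu> (Suc n)) \<le> \<theta> * moment (2 * p) (\<nu> n)"
      using midpoint_law_moment(2)[OF assms(1), of "\<nu> n"] Suc by (simp add: \<nu>_def \<theta>_def)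
    also have "\<dots> \<le> \<theta> * (\<theta> ^ n * M)" using Suc \<theta> by (intro mult_left_mono) auto
    finally show ?case
      using midpoint_law_moment(1)[OF assms(1), of "\<nu> n"] Suc by (simp add: \<nu>_def mult.assoc)
  qed
  have chain: "\<exists>Q. noisy_coupling p \<mu> (\<nu> n) (\<Sum>k<n. K_const p * moment (2 * p) (\<nu> k) powr (1 / p)) Q" for n
  proof (induction n)
    case 0
    then show ?case using noisy_coupling_self[OF assms(2,3)] by (simp add: \<nu>_def)
  next
    case (Suc n)
    then obtain Q where "noisy_coupling p \<mu> (\<nu> n) (\<Sum>k<n. K_const p * moment (2 * p) (\<nu> k) powr (1 / p)) Q" by blast
    from noisy_coupling_step[OF assms(1) _ _ this] \<nu>[of n] K show ?case
      by (simp add: \<nu>_def sum_nonneg)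
  qed
  have sum_le: "(\<Sum>k<n. K_const p * moment (2 * p) (\<nu> k) powr (1 / p)) \<le> B" for n
  proof -
    have "(\<Sum>k<n. K_const p * moment (2 * p) (\<nu> k) powr (1 / p)) \<le> (\<Sum>k<n. K_const p * (r ^ k * M powr (1 / p)))"
    proof (intro sum_mono mult_left_mono)
      fix k
      have "moment (2 * p) (\<nu> k) powr (1 / p) \<le> (\<theta> ^ k * M) powr (1 / p)"
        using \<nu>[of k] assms(1) moment_nonneg by (intro powr_mono2) auto
      also have "\<dots> = r ^ k * M powr (1 / p)"
        using \<theta>(1) by (simp add: powr_mult r_def powr_powr mult.commute flip: powr_realpow)
      finally show "moment (2 * p) (\<nu> k) powr (1 / p) \<le> r ^ k * M powr (1 / p)" .
    qed (use K in auto)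
    also have "\<dots> = (\<Sum>k<n. K_const p * M powr (1 / p) * r ^ k)"
      by (simp only: mult_ac)
    also have "\<dots> = K_const p * M powr (1 / p) * (\<Sum>k<n. r ^ k)"
      by (rule sum_distrib_left[symmetric])
    also have "\<dots> \<le> K_const p * M powr (1 / p) * (1 / (1 - r))"
      using r K by (intro mult_left_mono) (auto simp: sum_gp_strict divide_right_mono)
    finally show ?thesis by (simp add: B_def)
  qed
  \<comment> \<open>The number of steps depends on e, but the accumulated cost is bounded by B for
    every number of steps.\<close>
  have "(INF \<tau>\<in>couplings (\<mu> \<star> std_gaussian) std_gaussian. \<integral>\<^sup>+ z. ennreal (norm (fst z - snd z) powr p) \<partial>\<tau>)
    \<le> ennreal ((B + e) powr p)" if e: "0 < e" for e
  proof -
    have "(\<lambda>n. \<theta> ^ n * M) \<longlonglongrightarrow> 0 * M"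
      using \<theta> by (intro tendsto_intros LIMSEQ_power_zero) auto
    then have "eventually (\<lambda>n. \<theta> ^ n * M < e powr (2 * p)) sequentially"
      using e by (intro order_tendstoD) auto
    then obtain n where n: "\<theta> ^ n * M < e powr (2 * p)"
      using eventually_sequentially by auto
    define A where "A = (\<Sum>k<n. K_const p * moment (2 * p) (\<nu> k) powr (1 / p))"
    have A: "0 \<le> A" unfolding A_def using K by (intro sum_nonneg) auto
    obtain Q where Q: "noisy_coupling p \<mu> (\<nu> n) A Q" using chain[of n] unfolding A_def by blast
    have "(INF \<tau>\<in>couplings (\<mu> \<star> std_gaussian) std_gaussian. \<integral>\<^sup>+ z. ennreal (norm (fst z - snd z) powr p) \<partial>\<tau>)
      \<le> ennreal ((A + e) powr p)"
      using \<nu>[of n] n A e by (intro noisy_coupling_imp_transport_cost[OF assms(1) _ _ _ _ Q]) auto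
    also have "\<dots> \<le> ennreal ((B + e) powr p)"
      using sum_le[of n] A e assms(1) by (intro ennreal_leI powr_mono2) (auto simp: A_def)
    finally show ?thesis .
  qed
  then have "wasserstein p (\<mu> \<star> std_gaussian) std_gaussian \<le> ennreal B"
    unfolding wasserstein_def using assms(1) B by (intro ennreal_powr_le_limit) auto
  then show ?thesis by (simp add: B_def M_def moment_def r_def \<theta>_def)
qed

end
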